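(* Assume $a \ge b > 0$ and $0 < n < 1$. Consider the system $$\frac{d\mu}{d\varphi}=\frac{e^{-\mu(\varphi)}(\cos \zeta(\varphi)-n)}{f(\varphi)},\qquad \frac{d\zeta}{d\varphi}=-\frac{e^{-\mu(\varphi)}\sin \zeta(\varphi)}{f(\varphi)}+1,\qquad f(\varphi)=\frac{(a^2\sin^2\varphi+b^2\cos^2\varphi)^{3/2}}{a^2b^2},$$ with $(\mu,\zeta)\in\mathbb{R}^2$, where $\zeta$ is considered modulo $2\pi$, so that a solution is identified with the complex-valued function $z(\varphi)=e^{\mu(\varphi)+i\zeta(\varphi)}$. Then the system has exactly one $\pi$-periodic solution $z^*$ (i.e. $z^*(\varphi+\pi)=z^*(\varphi)$ for all $\varphi$), and all solutions $(\mu,\zeta)\in\mathbb{R}^2$ converge asymptotically to this periodic solution: for every solution $z=e^{\mu+i\zeta}$, $|z(\varphi)-z^*(\varphi)|\to 0$ as $\varphi\to\infty$.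
   Context: The system describes pursuit of an evader moving counterclockwise at unit speed on the ellipse $X^2/a^2+Y^2/b^2=1$ by a pursuer of constant speed $n$ whose velocity always points toward the evader. The independent variable $\varphi$ is the argument (direction angle) of the evader's velocity, $e^{\mu}$ is the distance between the players, and $\zeta$ is the argument of the evader's velocity minus the argument of the pursuer's velocity. The real parameters are $a,b,n$. In terms of $z=e^{\mu+i\zeta}$ the system is equivalent to the complex ordinary differential equation $$\frac{dz}{d\varphi}=\frac{1}{f(\varphi)}-\frac{n}{f(\varphi)}\frac{z}{|z|}+iz,\qquad z\neq 0.$$
   Formalization: Convergence is stated for every solution that exists for all large φ; some solutions reach z = 0 head-on (ζ → π) at a finite φ and cannot be continued, so for them the limit φ → ∞ has no meaning. *)

theory Defs
  imports "HOL-Analysis.Analysis"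
begin

(* f is the curvature of the ellipse X^2/a^2 + Y^2/b^2 = 1 at the point
   where the tangent vector of the counterclockwise parametrization has argument phi. *)
definition ellipse_f :: "real \<Rightarrow> real \<Rightarrow> real \<Rightarrow> real" where
  "ellipse_f a b \<phi> = (a\<^sup>2 * (sin \<phi>)\<^sup>2 + b\<^sup>2 * (cos \<phi>)\<^sup>2) powr (3/2) / (a\<^sup>2 * b\<^sup>2)"

(* Only the values on T matter; T is meant to be a nondegenerate interval, with one-sided
   derivatives at those endpoints that belong to T. *)
definition pursuit_solution ::
  "real \<Rightarrow> real \<Rightarrow> real \<Rightarrow> real set \<Rightarrow> (real \<Rightarrow> real) \<Rightarrow> (real \<Rightarrow> real) \<Rightarrow> bool" where
  "pursuit_solution a b n T \<mu> \<zeta> \<longleftrightarrow>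
     (\<forall>\<phi>\<in>T.
        (\<mu> has_real_derivative
           exp (- \<mu> \<phi>) * (cos (\<zeta> \<phi>) - n) / ellipse_f a b \<phi>) (at \<phi> within T) \<and>
        (\<zeta> has_real_derivative
           - (exp (- \<mu> \<phi>) * sin (\<zeta> \<phi>) / ellipse_f a b \<phi>) + 1) (at \<phi> within T))"

definition pursuit_curve :: "(real \<Rightarrow> real) \<Rightarrow> (real \<Rightarrow> real) \<Rightarrow> real \<Rightarrow> complex" where
  "pursuit_curve \<mu> \<zeta> \<phi> = exp (complex_of_real (\<mu> \<phi>) + \<i> * complex_of_real (\<zeta> \<phi>))"

(* Since zeta is an angle, solutions are compared, and periodicity is required, only for the
   complex curve: zeta itself may increase by a multiple of 2 pi over a period. *)
definition periodic_pursuit_solution ::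
  "real \<Rightarrow> real \<Rightarrow> real \<Rightarrow> (real \<Rightarrow> complex) \<Rightarrow> bool" where
  "periodic_pursuit_solution a b n z \<longleftrightarrow>
     (\<exists>\<mu> \<zeta>. pursuit_solution a b n UNIV \<mu> \<zeta> \<and> z = pursuit_curve \<mu> \<zeta>) \<and>
     (\<forall>\<phi>. z (\<phi> + pi) = z \<phi>)"

end

theory Submission
  imports Defs
begin

text \<open>
  In the non-rotating frame \<open>w = cis (- t) * z\<close> the equation reads \<open>w' = cis (- t) / f - n / f * sgn w\<close>.
  Since \<open>sgn\<close> is the gradient of the convex function \<open>norm\<close>, the distance of two solutions never
  increases. If it does not tend to \<open>0\<close>, then in the limit the difference of the solutions is a constant
  vector \<open>v\<close> to which the periodic solution is parallel all the time; differentiating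
  \<open>Im (cnj w * v) = 0\<close> gives \<open>v = 0\<close>.

  For existence, \<open>sgn w\<close> is replaced by the Lipschitz field \<open>w / max (norm w) d\<close>. Its period map is
  nonexpansive and preserves a disc, so Brouwer's theorem yields a periodic orbit of the regularised
  equation. The pursuer stays inside the ellipse on this orbit, that is, \<open>Im z \<ge> 0\<close>. It remains to bound
  \<open>norm z\<close> from below independently of \<open>d\<close>. After a near collision at time \<open>t0\<close> the pursuer's heading has
  turned past the evader's direction at time \<open>t0\<close>, so \<open>z\<close> stays away from the negative real axis
  until time \<open>t0 + pi\<close>. Outside the negative real axis the logarithm of
  \<open>Im z powr (1 - n) * (norm z + Re z) powr n\<close> decreases at a bounded rate only, which excludes
  a near collision at time \<open>t0 + pi\<close>, contradicting periodicity.
\<close>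

subsection \<open>Calculus and the global Picard--Lindelof theorem\<close>

text \<open>After the last time \<open>c\<close> with \<open>v c <= 0\<close> the function is
  positive, hence nonincreasing, so \<open>v b <= v c\<close>.\<close>

lemma nonpos_forward_invariant:
  fixes v v' :: "real \<Rightarrow> real"
  assumes "a \<le> b" and "v a \<le> 0"
    and deriv: "\<And>t. t \<in> {a..b} \<Longrightarrow> (v has_real_derivative v' t) (at t within {a..b})"
    and decr: "\<And>t. t \<in> {a..b} \<Longrightarrow> v t > 0 \<Longrightarrow> v' t \<le> 0"
  shows "v b \<le> 0"
proof (rule ccontr)
  assume "\<not> v b \<le> 0"
  then have vb: "v b > 0" by simp
  have cont: "continuous_on {a..b} v"
    using deriv by (intro DERIV_continuous_on)
  define S where "S = {t \<in> {a..b}. v t \<le> 0}"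
  have "closed S" unfolding S_def
    by (intro continuous_on_closed_Collect_le cont continuous_intros)
  moreover have "bounded S" unfolding S_def
    by (rule bounded_subset[of "{a..b}"]) auto
  ultimately have "compact S" by (simp add: compact_eq_bounded_closed)
  moreover have "a \<in> S" using assms(1,2) by (simp add: S_def)
  ultimately obtain c where c: "c \<in> S" "\<And>t. t \<in> S \<Longrightarrow> t \<le> c"
    using compact_attains_sup[of S] by blast
  have pos: "v t > 0" if "c < t" "t \<le> b" for t
    using c that unfolding S_def by (metis (mono_tags, lifting) atLeastAtMost_iff
        less_eq_real_def linorder_not_le mem_Collect_eq order_trans)
  have "v b \<le> v c"
  proof (rule DERIV_nonpos_imp_decreasing_open[of c b v])
    show "c \<le> b" using c(1) by (simp add: S_def)
    show "continuous_on {c..b} v"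
      by (rule continuous_on_subset[OF cont]) (use c(1) in \<open>auto simp: S_def\<close>)
    fix t assume t: "c < t" "t < b"
    then have "a < t" using c(1) by (simp add: S_def)
    then show "\<exists>y. (v has_real_derivative y) (at t) \<and> y \<le> 0"
      using deriv[of t] decr[of t] pos[of t] t by (auto simp: at_within_Icc_at)
  qed
  then show False using c(1) vb by (simp add: S_def)
qed

lemma integral_has_vector_derivative_atLeast:
  fixes f :: "real \<Rightarrow> 'a::banach"
  assumes f: "continuous_on {0..} f" and "0 \<le> \<tau>"
  shows "((\<lambda>t. integral {0..t} f) has_vector_derivative f \<tau>) (at \<tau> within {0..})"
proof -
  have "((\<lambda>t. integral {0..t} f) has_vector_derivative f \<tau>) (at \<tau> within {0..\<tau>+1})"
    using assms by (intro integral_has_vector_derivative) (auto intro: continuous_on_subset)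
  moreover have "at \<tau> within {0..\<tau>+1} = at \<tau> within {0..}"
    by (rule at_within_nhd[where S="{..<\<tau>+1}"]) auto
  ultimately show ?thesis by simp
qed

text \<open>Picard iteration in the weighted variable \<open>u t = exp (- l * t) * x t\<close>: the
  weight makes the operator a contraction on bounded continuous functions, so the whole half-line is
  reached at once. The bound on \<open>F\<close> keeps the weighted iterates bounded.\<close>

lemma picard_lindelof_global:
  fixes F :: "real \<Rightarrow> 'a::banach \<Rightarrow> 'a"
  assumes cont: "continuous_on UNIV (\<lambda>(t, x). F t x)"
    and bound: "\<And>t x. norm (F t x) \<le> B"
    and lip: "\<And>t x y. norm (F t x - F t y) \<le> L * norm (x - y)"
  shows "\<exists>x. x 0 = q \<and>
    (\<forall>t\<ge>0. (x has_vector_derivative F t (x t)) (at t within {0..}))"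
proof -
  \<comment> \<open>\<open>max L 1\<close> is positive whatever \<open>L\<close> is; the factor 2
    yields the contraction constant 1/2.\<close>
  define l where "l = 2 * max L 1"
  have l: "l > 0" "L / l \<le> 1/2" unfolding l_def by (auto simp: field_simps)
  have B: "B \<ge> 0" using bound[of 0 0] norm_ge_zero order_trans by blast
  have cF: "continuous_on S (\<lambda>s. F s (v s))" if "continuous_on S v" for v and S :: "real set"
    using continuous_on_compose2[OF cont continuous_on_Pair[OF continuous_on_id that]] by simp
  define V where "V u t = q + integral {0..t} (\<lambda>s. F s (exp (l * s) *\<^sub>R apply_bcontfun u s))"
    for u and t :: real
  have V_deriv: "(V u has_vector_derivative F t (exp (l * t) *\<^sub>R apply_bcontfun u t)) (at t within {0..})"
    if "t \<ge> 0" for u t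
    unfolding V_def using that
    by (auto intro!: derivative_eq_intros integral_has_vector_derivative_atLeast cF
        continuous_intros continuous_on_apply_bcontfun)
  have V_cont: "continuous_on {0..} (V u)" for u
    unfolding continuous_on_eq_continuous_within
    using V_deriv has_vector_derivative_continuous by (metis atLeast_iff)
  \<comment> \<open>The Picard operator in the weighted variable; \<open>max 0 t\<close> extends it
    to negative \<open>t\<close>, since a \<open>bcontfun\<close> lives on all reals.\<close>
  define K where "K u t = exp (- l * max 0 t) *\<^sub>R V u (max 0 t)" for u and t :: real
  have int: "(\<lambda>s. F s (exp (l * s) *\<^sub>R apply_bcontfun u s)) integrable_on {0..t}" for u t
    by (intro integrable_continuous_real cF continuous_intros continuous_on_apply_bcontfun)
  have K_bcont: "K u \<in> bcontfun" for u
  proof -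
    have "continuous_on UNIV (K u)"
      unfolding K_def
      by (intro continuous_intros continuous_on_compose2[OF V_cont]) auto
    moreover have "norm (K u t) \<le> norm q + B / l" for t
    proof -
      define \<tau> where "\<tau> = max 0 t"
      have \<tau>: "\<tau> \<ge> 0" by (simp add: \<tau>_def)
      have "norm (V u \<tau>) \<le> norm q + B * \<tau>"
      proof -
        have "continuous_on {0..\<tau>} (\<lambda>s. F s (exp (l * s) *\<^sub>R apply_bcontfun u s))"
          by (intro cF continuous_intros continuous_on_apply_bcontfun)
        from integral_bound[OF \<tau> this, of B] bound show ?thesis
          unfolding V_def by (intro order_trans[OF norm_triangle_ineq]) auto
      qed
      moreover have "exp (- l * \<tau>) * (norm q + B * \<tau>) \<le> norm q + B / l"
      proof -
        have "l * \<tau> \<le> exp (l * \<tau>)" using exp_ge_add_one_self[of "l*\<tau>"] by linarith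
        then have "exp (- l * \<tau>) * \<tau> \<le> 1 / l"
          using l by (simp add: exp_minus field_simps)
        then have "B * (exp (- l * \<tau>) * \<tau>) \<le> B * (1 / l)" using B by (intro mult_left_mono)
        moreover have "exp (- l * \<tau>) * norm q \<le> 1 * norm q"
          using l \<tau> by (intro mult_right_mono) auto
        ultimately show ?thesis by (simp add: algebra_simps)
      qed
      ultimately show ?thesis unfolding K_def \<tau>_def[symmetric]
        by (simp, meson exp_ge_zero mult_left_mono order_trans)
    qed
    ultimately show ?thesis
      unfolding bcontfun_def bounded_iff by auto
  qed
  have contr: "dist (Bcontfun (K u)) (Bcontfun (K v)) \<le> 1/2 * dist u v" for u v
  proof (rule dist_bound)
    fix t :: real
    define \<tau> where "\<tau> = max 0 t"
    have \<tau>: "\<tau> \<ge> 0" by (simp add: \<tau>_def)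
    define d where "d = dist u v"
    have "V u \<tau> - V v \<tau> = integral {0..\<tau>} (\<lambda>s. F s (exp (l * s) *\<^sub>R apply_bcontfun u s) 
        - F s (exp (l * s) *\<^sub>R apply_bcontfun v s))"
      unfolding V_def by (simp add: integral_diff int)
    also have "norm \<dots> \<le> integral {0..\<tau>} (\<lambda>s. max L 1 * d * exp (l * s))"
    proof (rule integral_norm_bound_integral)
      fix s assume "s \<in> {0..\<tau>}"
      have "norm (F s (exp (l * s) *\<^sub>R apply_bcontfun u s) - F s (exp (l * s) *\<^sub>R apply_bcontfun v s))
        \<le> L * norm (exp (l * s) *\<^sub>R apply_bcontfun u s - exp (l * s) *\<^sub>R apply_bcontfun v s)"
        by (rule lip)
      also have "\<dots> \<le> max L 1 * (exp (l * s) * dist (apply_bcontfun u s) (apply_bcontfun v s))"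
        by (intro mult_mono) (auto simp: dist_norm simp flip: scaleR_diff_right)
      also have "\<dots> \<le> max L 1 * (exp (l * s) * d)"
        unfolding d_def by (intro mult_left_mono dist_bounded) auto
      finally show "norm (F s (exp (l * s) *\<^sub>R apply_bcontfun u s) 
          - F s (exp (l * s) *\<^sub>R apply_bcontfun v s)) \<le> max L 1 * d * exp (l * s)"
        by (simp add: mult_ac)
    qed (intro integrable_diff int, intro integrable_continuous_real continuous_intros)
    also have "\<dots> = d / 2 * (exp (l * \<tau>) - 1)"
    proof -
      have "((\<lambda>s. max L 1 * d * exp (l * s)) has_integral
          (d / 2 * exp (l * \<tau>) - d / 2 * exp (l * 0))) {0..\<tau>}"
        using \<tau> by (intro fundamental_theorem_of_calculus)
          (auto intro!: derivative_eq_intros simp: has_real_derivative_iff_has_vector_derivative[symmetric] l_def)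
      from integral_unique[OF this] show ?thesis by (simp only: right_diff_distrib) simp
    qed
    finally have "exp (- l * \<tau>) * norm (V u \<tau> - V v \<tau>) \<le> exp (- l * \<tau>) * (d / 2 * (exp (l * \<tau>) - 1))"
      by (intro mult_left_mono) auto
    also have "\<dots> \<le> d / 2" by (simp add: exp_minus field_simps d_def)
    finally show "dist (apply_bcontfun (Bcontfun (K u)) t) (apply_bcontfun (Bcontfun (K v)) t) \<le> 1/2 * dist u v"
      unfolding Bcontfun_inverse[OF K_bcont] K_def \<tau>_def[symmetric] d_def[symmetric]
      by (simp add: dist_norm flip: scaleR_diff_right)
  qed
  obtain u where u: "Bcontfun (K u) = u"
    using banach_fix_type[of "1/2" "\<lambda>u. Bcontfun (K u)"] contr by auto
  then have u: "apply_bcontfun u = K u" using Bcontfun_inverse[OF K_bcont] by metis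
  have uV: "exp (l * t) *\<^sub>R apply_bcontfun u t = V u t" if "t \<ge> 0" for t
    using that unfolding u by (simp add: K_def flip: exp_add)
  show ?thesis
    using V_deriv[of _ u] uV by (intro exI[of _ "V u"]) (auto simp: V_def)
qed

lemma has_real_derivative_inner_self:
  fixes f :: "real \<Rightarrow> 'a::real_inner"
  assumes "(f has_vector_derivative f') (at t within S)"
  shows "((\<lambda>t. f t \<bullet> f t) has_real_derivative 2 * (f t \<bullet> f')) (at t within S)"
proof -
  have "((\<lambda>t. f t \<bullet> f t) has_derivative (\<lambda>h. f t \<bullet> (h *\<^sub>R f') + (h *\<^sub>R f') \<bullet> f t)) (at t within S)"
    using assms unfolding has_vector_derivative_def by (intro has_derivative_inner)
  then show ?thesis
    unfolding has_field_derivative_def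
    by (rule has_derivative_eq_rhs) (auto simp: inner_commute)
qed

lemma periodic_attains_inf:
  fixes f :: "real \<Rightarrow> real"
  assumes "continuous_on UNIV f" and "\<And>t. f (t + p) = f t" and "p > 0"
  obtains t0 where "\<And>t. f t0 \<le> f t"
proof -
  interpret periodic_fun_simple f p by unfold_locales (rule assms)
  have "compact {0..p}" "{0..p} \<noteq> {}" using assms(3) by auto
  then obtain t0 where t0: "\<And>t. t \<in> {0..p} \<Longrightarrow> f t0 \<le> f t"
    using continuous_attains_inf[of "{0..p}" f] assms(1) continuous_on_subset by blast
  have "f t0 \<le> f t" for t
  proof -
    define k where "k = \<lfloor>t / p\<rfloor>"
    have "of_int k \<le> t / p" "t / p < of_int k + 1" unfolding k_def by linarith+
    then have "t - of_int k * p \<in> {0..p}" using assms(3) by (auto simp: field_simps)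
    then show ?thesis using t0[of "t - of_int k * p"] plus_of_int[of "t - of_int k * p" k] by simp
  qed
  then show ?thesis using that by blast
qed

subsection \<open>Periodic orbits of the regularised pursuit\<close>

text \<open>For \<open>d > 0\<close> the gradient of the Huber function, which is
  \<open>norm w ^ 2 / (2 * d)\<close> inside the disc of radius \<open>d\<close> and
  \<open>norm w - d / 2\<close> outside: a Lipschitz version of \<open>sgn\<close> that still comes
  from a convex function.\<close>

definition soft_dir :: "real \<Rightarrow> 'a::real_inner \<Rightarrow> 'a" where
  "soft_dir d w = (1 / max (norm w) d) *\<^sub>R w"

lemma soft_dir_minus: "soft_dir d (- w) = - soft_dir d w"
  by (simp add: soft_dir_def)

lemma soft_dir_eq: "norm w \<ge> d \<Longrightarrow> soft_dir d w = (1 / norm w) *\<^sub>R w"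
  by (simp add: soft_dir_def max_def)

lemma norm_soft_dir_le: "d > 0 \<Longrightarrow> norm (soft_dir d w) \<le> 1"
  by (simp add: soft_dir_def divide_simps max_def)

text \<open>Changing the vector and changing the normalising factor cost at most
  \<open>norm (v - w) / d\<close> each.\<close>

lemma soft_dir_lipschitz:
  assumes "d > 0"
  shows "norm (soft_dir d v - soft_dir d w) \<le> 2 / d * norm (v - w)"
proof -
  define a b where "a = max (norm v) d" and "b = max (norm w) d"
  have ab: "a \<ge> d" "b \<ge> d" "norm w \<le> b" by (auto simp: a_def b_def)
  have "\<bar>a - b\<bar> \<le> \<bar>norm v - norm w\<bar>" by (auto simp: a_def b_def max_def)
  also have "\<dots> \<le> norm (v - w)" by (rule norm_triangle_ineq3)
  finally have abd: "\<bar>a - b\<bar> \<le> norm (v - w)" .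
  have "soft_dir d v - soft_dir d w = (1 / a) *\<^sub>R (v - w) + ((b - a) / a) *\<^sub>R ((1 / b) *\<^sub>R w)"
    using ab assms by (simp add: soft_dir_def a_def[symmetric] b_def[symmetric]
        scaleR_diff_right diff_divide_distrib scaleR_diff_left)
  also have "norm \<dots> \<le> (1 / a) * norm (v - w) + (\<bar>b - a\<bar> / a) * (norm w / b)"
    using ab assms by (intro order_trans[OF norm_triangle_ineq]) auto
  also have "\<dots> \<le> (1 / d) * norm (v - w) + (norm (v - w) / d) * 1"
    using ab assms abd by (intro add_mono mult_mono frac_le) (auto simp: divide_simps)
  finally show ?thesis by simp
qed

lemma continuous_on_soft_dir [continuous_intros]:
  assumes "d > 0" "continuous_on S f"
  shows "continuous_on S (\<lambda>x. soft_dir d (f x))"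
  unfolding soft_dir_def using assms by (intro continuous_intros) (auto simp: max_def)

text \<open>By Cauchy--Schwarz the claim reduces to the monotonicity of the scalar function
  \<open>r / max r d\<close>.\<close>

lemma soft_dir_monotone:
  assumes "d > 0"
  shows "0 \<le> (soft_dir d v - soft_dir d w) \<bullet> (v - w)"
proof -
  define a b where "a = 1 / max (norm v) d" and "b = 1 / max (norm w) d"
  have ab: "a > 0" "b > 0" using assms by (auto simp: a_def b_def max_def)
  have mono: "r / max r d \<le> s / max s d" if "0 \<le> r" "r \<le> s" for r s
    using that assms by (auto simp: max_def field_simps)
  have "0 \<le> (a * norm v - b * norm w) * (norm v - norm w)"
    using mono[of "norm v" "norm w"] mono[of "norm w" "norm v"]
    by (cases "norm v \<le> norm w") (auto simp: a_def b_def intro!: mult_nonneg_nonneg mult_nonpos_nonpos)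
  also have "\<dots> = a * (norm v)\<^sup>2 + b * (norm w)\<^sup>2 - (a + b) * (norm v * norm w)"
    by (simp add: algebra_simps power2_eq_square)
  also have "\<dots> \<le> a * (norm v)\<^sup>2 + b * (norm w)\<^sup>2 - (a + b) * (v \<bullet> w)"
    using ab by (intro diff_mono mult_left_mono norm_cauchy_schwarz) auto
  also have "\<dots> = (soft_dir d v - soft_dir d w) \<bullet> (v - w)"
    unfolding soft_dir_def a_def[symmetric] b_def[symmetric]
    by (simp add: algebra_simps inner_commute dot_square_norm)
  finally show ?thesis .
qed

text \<open>The evader runs on a centrally symmetric closed convex curve: \<open>g\<close> is the
  radius of curvature as a function of the argument of the tangent, and \<open>G_support\<close>
  says that the curve lies on one side of each of its tangents.\<close>

locale closed_pursuit =
  fixes g :: "real \<Rightarrow> real" and G :: "real \<Rightarrow> complex" and n :: real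
  assumes n_pos: "0 < n" and n_less_1: "n < 1"
    and g_cont: "continuous_on UNIV g" and g_pos: "\<And>t. 0 < g t" and g_periodic: "\<And>t. g (t + pi) = g t"
    and G_deriv: "\<And>t. (G has_vector_derivative g t *\<^sub>R cis (- t)) (at t)"
    and G_antiperiodic: "\<And>t. G (t + pi) = - G t"
    and G_support: "\<And>s t. Im (cis s * G t) \<le> Im (cis s * G s)"
begin

lemma g_bounds:
  obtains g0 g1 where "0 < g0" "\<And>t. g0 \<le> g t" "\<And>t. g t \<le> g1"
proof -
  obtain t0 where "\<And>t. g t0 \<le> g t"
    using periodic_attains_inf[OF g_cont g_periodic] pi_gt_zero by blast
  moreover have c: "continuous_on UNIV (\<lambda>t. - g t)" by (intro continuous_intros g_cont)
  have p: "- g (t + pi) = - g t" for t by (simp add: g_periodic)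
  obtain t1 where "\<And>t. - g t1 \<le> - g t"
    using periodic_attains_inf[OF c p pi_gt_zero] by blast
  ultimately show ?thesis using that[of "g t0" "g t1"] g_pos by auto
qed

lemma G_cont: "continuous_on S G"
  using G_deriv by (meson continuous_at_imp_continuous_on has_vector_derivative_continuous)

lemma G_bound:
  obtains M where "0 < M" "\<And>t. norm (G t) \<le> M"
proof -
  have c: "continuous_on UNIV (\<lambda>t. - norm (G t))" by (intro continuous_intros G_cont)
  have p: "- norm (G (t + pi)) = - norm (G t)" for t by (simp add: G_antiperiodic)
  obtain t1 where t1: "\<And>t. - norm (G t1) \<le> - norm (G t)"
    using periodic_attains_inf[OF c p pi_gt_zero] by blast
  then have "norm (G t) \<le> norm (G t1) + 1" for t by (smt (verit))
  then show ?thesis using that[of "norm (G t1) + 1"] norm_ge_zero[of "G t1"] by auto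
qed

text \<open>The unknown is \<open>q = w - G t\<close>. Since \<open>G\<close> integrates the forcing
  term \<open>cis (- t) / f\<close>, only the pull towards \<open>- G t\<close> is left.\<close>

definition soft_field :: "real \<Rightarrow> real \<Rightarrow> complex \<Rightarrow> complex" where
  "soft_field d t q = - ((n * g t) *\<^sub>R soft_dir d (q + G t))"

lemma soft_field_antiperiodic: "soft_field d (t + pi) (- q) = - soft_field d t q"
proof -
  have "soft_dir d (- q + G (t + pi)) = - soft_dir d (q + G t)"
    by (metis G_antiperiodic add_uminus_conv_diff minus_add_distrib soft_dir_minus)
  then show ?thesis by (simp add: soft_field_def g_periodic)
qed

section \<open>Forward solutions of the regularised equation\<close>

definition soft_flow :: "real \<Rightarrow> (real \<Rightarrow> complex) \<Rightarrow> bool" where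
  "soft_flow d Q \<longleftrightarrow>
     (\<forall>t\<ge>0. (Q has_vector_derivative soft_field d t (Q t)) (at t within {0..}))"

lemma soft_flow_exists:
  assumes "d > 0"
  shows "\<exists>Q. Q 0 = q \<and> soft_flow d Q"
  unfolding soft_flow_def
proof -
  obtain g0 g1 where g: "0 < g0" "\<And>t. g0 \<le> g t" "\<And>t. g t \<le> g1" by (rule g_bounds) blast
  have ng: "0 \<le> n * g t" "n * g t \<le> n * g1" for t
    using n_pos g_pos[of t] g(3)[of t] by auto
  show "\<exists>Q. Q 0 = q \<and> (\<forall>t\<ge>0. (Q has_vector_derivative soft_field d t (Q t)) (at t within {0..}))"
  proof (rule picard_lindelof_global)
    have "continuous_on UNIV (\<lambda>p. soft_field d (fst p) (snd p))"
      unfolding soft_field_def using assms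
      by (intro continuous_intros continuous_on_compose2[OF g_cont] continuous_on_compose2[OF G_cont]) auto
    then show "continuous_on UNIV (\<lambda>(t, x). soft_field d t x)"
      by (simp add: case_prod_unfold)
    show "norm (soft_field d t x) \<le> n * g1" for t x
      using mult_mono[OF ng(2)[of t] norm_soft_dir_le[OF assms, of "x + G t"]] ng(1)[of t] ng(2)[of t]
      by (simp add: soft_field_def)
    show "norm (soft_field d t x - soft_field d t y) \<le> (n * g1 * (2 / d)) * norm (x - y)" for t x y
    proof -
      have "norm (soft_field d t x - soft_field d t y)
          = n * g t * norm (soft_dir d (x + G t) - soft_dir d (y + G t))"
        unfolding soft_field_def using ng(1)[of t]
        by (metis abs_of_nonneg minus_diff_minus norm_minus_cancel norm_scaleR scaleR_diff_right)
      also have "\<dots> \<le> n * g1 * (2 / d * norm ((x + G t) - (y + G t)))"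
        using g(3)[of t] g_pos[of t] n_pos by (intro mult_mono soft_dir_lipschitz assms) (auto intro: less_imp_le)
      finally show ?thesis by simp
    qed
  qed
qed

text \<open>Half the derivative of the squared distance is \<open>- n * g\<close> times the
  expression in \<open>soft_dir_monotone\<close>.\<close>

lemma soft_flow_nonexpansive:
  assumes "d > 0" "soft_flow d P" "soft_flow d Q" "t \<ge> 0"
  shows "norm (P t - Q t) \<le> norm (P 0 - Q 0)"
proof -
  define v where "v = (\<lambda>t. (P t - Q t) \<bullet> (P t - Q t) - (P 0 - Q 0) \<bullet> (P 0 - Q 0))"
  define v' where "v' = (\<lambda>t. 2 * ((P t - Q t) \<bullet> (soft_field d t (P t) - soft_field d t (Q t))))"
  have "v t \<le> 0"
  proof (rule nonpos_forward_invariant[of 0 t v v'])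
    fix s assume s: "s \<in> {0..t}"
    have "((\<lambda>t. P t - Q t) has_vector_derivative soft_field d s (P s) - soft_field d s (Q s)) (at s within {0..t})"
      by (rule has_vector_derivative_within_subset[where S="{0..}"])
        (use assms s in \<open>auto simp: soft_flow_def intro!: has_vector_derivative_diff\<close>)
    from has_real_derivative_inner_self[OF this]
    show "(v has_real_derivative v' s) (at s within {0..t})"
      unfolding v_def v'_def by (auto intro!: derivative_eq_intros)
    have "soft_field d s (P s) - soft_field d s (Q s)
        = - ((n * g s) *\<^sub>R (soft_dir d (P s + G s) - soft_dir d (Q s + G s)))"
      by (simp add: soft_field_def algebra_simps)
    moreover have "0 \<le> (soft_dir d (P s + G s) - soft_dir d (Q s + G s)) \<bullet> (P s - Q s)"
      using soft_dir_monotone[OF assms(1), of "P s + G s" "Q s + G s"] by simp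
    ultimately show "v' s \<le> 0"
      unfolding v'_def using n_pos g_pos[of s]
      by (simp add: inner_commute mult_nonneg_nonneg)
  qed (use assms in \<open>auto simp: v_def\<close>)
  then show ?thesis unfolding v_def by (simp add: dot_square_norm)
qed

lemma soft_flow_unique:
  assumes "d > 0" "soft_flow d P" "soft_flow d Q" "P 0 = Q 0" "t \<ge> 0"
  shows "P t = Q t"
  using soft_flow_nonexpansive[OF assms(1-3,5)] assms(4) by simp

text \<open>The inner product of \<open>q\<close> and \<open>q + G t\<close> is at least
  \<open>norm q * (norm q - norm (G t))\<close>. Thus the field does not point outwards outside a
  disc that contains the curve.\<close>

lemma soft_field_inward:
  assumes "d > 0" "norm (G t) \<le> norm q"
  shows "q \<bullet> soft_field d t q \<le> 0"
proof -
  have "q \<bullet> (q + G t) \<ge> norm q ^ 2 - norm q * norm (G t)"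
    using norm_cauchy_schwarz[of q "- G t"] by (simp add: inner_add_right dot_square_norm)
  moreover have "norm q ^ 2 - norm q * norm (G t) \<ge> 0"
    using assms(2) by (simp add: power2_eq_square mult_left_mono)
  ultimately have "q \<bullet> (q + G t) \<ge> 0" by linarith
  then show ?thesis
    unfolding soft_field_def soft_dir_def using assms(1) n_pos g_pos[of t]
    by (simp add: max_def)
qed

lemma soft_flow_disc:
  assumes "d > 0" "soft_flow d Q" "\<And>t. norm (G t) \<le> M" "norm (Q 0) \<le> M" "t \<ge> 0"
  shows "norm (Q t) \<le> M"
proof -
  have M: "M \<ge> 0" using assms(4) norm_ge_zero order_trans by blast
  define v where "v = (\<lambda>t. Q t \<bullet> Q t - M\<^sup>2)"
  have "v t \<le> 0"
  proof (rule nonpos_forward_invariant[of 0 t v "\<lambda>t. 2 * (Q t \<bullet> soft_field d t (Q t))"])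
    fix s assume s: "s \<in> {0..t}"
    have "(Q has_vector_derivative soft_field d s (Q s)) (at s within {0..t})"
      by (rule has_vector_derivative_within_subset[where S="{0..}"])
        (use assms s in \<open>auto simp: soft_flow_def\<close>)
    from has_real_derivative_inner_self[OF this]
    show "(v has_real_derivative 2 * (Q s \<bullet> soft_field d s (Q s))) (at s within {0..t})"
      unfolding v_def by (auto intro!: derivative_eq_intros)
    assume "v s > 0"
    then have "M\<^sup>2 < (norm (Q s))\<^sup>2" by (simp add: v_def dot_square_norm)
    then have "norm (G s) \<le> norm (Q s)" 
      using assms(3)[of s] by (meson less_imp_le norm_ge_zero order_trans power2_less_imp_less)
    then show "2 * (Q s \<bullet> soft_field d s (Q s)) \<le> 0"
      using soft_field_inward[OF assms(1)] by simp
  qed (use assms M in \<open>auto simp: v_def dot_square_norm\<close>)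
  then show ?thesis using M by (simp add: v_def dot_square_norm power2_le_iff_abs_le)
qed

text \<open>Half a turn maps the curve to itself with time advanced by \<open>pi\<close>, which is a
  symmetry of the equation.\<close>

lemma soft_flow_antiperiodic_shift:
  assumes "soft_flow d Q"
  shows "soft_flow d (\<lambda>t. - Q (t + pi))"
  unfolding soft_flow_def
proof safe
  fix t :: real assume t: "t \<ge> 0"
  have "(Q has_vector_derivative soft_field d (t + pi) (Q (t + pi))) (at (t + pi) within {0..})"
    using assms t pi_ge_zero by (auto simp: soft_flow_def)
  then have "(Q has_vector_derivative soft_field d (t + pi) (Q (t + pi))) (at (t + pi) within (\<lambda>t. t + pi) ` {0..})"
    by (rule has_vector_derivative_within_subset) auto
  then have "(Q \<circ> (\<lambda>t. t + pi) has_vector_derivative 1 *\<^sub>R soft_field d (t + pi) (Q (t + pi))) (at t within {0..})"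
    by (intro vector_diff_chain_within) (auto intro!: derivative_eq_intros)
  then have "((\<lambda>t. - Q (t + pi)) has_vector_derivative - soft_field d (t + pi) (Q (t + pi))) (at t within {0..})"
    by (auto intro!: has_vector_derivative_minus simp: o_def)
  then show "((\<lambda>t. - Q (t + pi)) has_vector_derivative soft_field d t (- Q (t + pi))) (at t within {0..})"
    using soft_field_antiperiodic[of d t "- Q (t + pi)"] by simp
qed

text \<open>Brouwer's theorem for the half-period map followed by a sign change, on a disc
  containing the curve. \<open>Q\<close> and its negated shift both start at the fixed point, so
  they agree by uniqueness.\<close>

lemma soft_flow_antiperiodic:
  assumes "d > 0"
  obtains Q where "soft_flow d Q" "\<And>t. t \<ge> 0 \<Longrightarrow> Q (t + pi) = - Q t"
proof -
  obtain M where M: "0 < M" "\<And>t. norm (G t) \<le> M" by (rule G_bound) blast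
  obtain \<Phi> where \<Phi>: "\<And>q. \<Phi> q 0 = q" "\<And>q. soft_flow d (\<Phi> q)"
    using soft_flow_exists[OF assms] by metis
  have "continuous_on (cball 0 M) (\<lambda>q. - \<Phi> q pi)"
  proof (rule continuous_onI)
    fix x and e :: real assume "e > 0"
    have "dist (- \<Phi> y pi) (- \<Phi> x pi) \<le> e" if "dist y x < e" for y
      using soft_flow_nonexpansive[OF assms \<Phi>(2) \<Phi>(2), of pi y x] \<Phi>(1) that
      by (simp add: dist_norm norm_minus_commute)
    then show "\<exists>d>0. \<forall>x'\<in>cball 0 M. dist x' x < d \<longrightarrow> dist (- \<Phi> x' pi) (- \<Phi> x pi) \<le> e"
      using \<open>e > 0\<close> by blast
  qed
  moreover have "(\<lambda>q. - \<Phi> q pi) \<in> cball 0 M \<rightarrow> cball 0 M"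
    using soft_flow_disc[OF assms \<Phi>(2) M(2), of _ pi] \<Phi>(1) by auto
  ultimately obtain q where q: "- \<Phi> q pi = q"
    using brouwer[of "cball (0::complex) M" "\<lambda>q. - \<Phi> q pi"] M(1) by auto
  have "- \<Phi> q (t + pi) = \<Phi> q t" if "t \<ge> 0" for t
    using soft_flow_unique[OF assms soft_flow_antiperiodic_shift[OF \<Phi>(2)[of q]] \<Phi>(2)[of q] _ that] q \<Phi>(1)
    by simp
  then show ?thesis using that[of "\<Phi> q"] \<Phi>(2) by (metis minus_minus)
qed

section \<open>Extension of antiperiodic solutions to all times\<close>

definition soft_orbit :: "real \<Rightarrow> (real \<Rightarrow> complex) \<Rightarrow> bool" where
  "soft_orbit d Q \<longleftrightarrow>
     (\<forall>t. (Q has_vector_derivative soft_field d t (Q t)) (at t)) \<and> (\<forall>t. Q (t + pi) = - Q t)"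

lemma soft_field_shift:
  "soft_field d (t + real k * pi) ((-1) ^ k * q) = (-1) ^ k * soft_field d t q"
proof (induction k)
  case (Suc k)
  have "soft_field d (t + real k * pi + pi) (- ((-1) ^ k * q)) = - ((-1) ^ k * soft_field d t q)"
    using soft_field_antiperiodic Suc by metis
  then show ?case by (simp add: algebra_simps)
qed simp

text \<open>Antiperiodicity dictates the value at a negative time: shift by enough half periods and
  correct the sign.\<close>

lemma soft_orbit_exists:
  assumes "d > 0"
  obtains R where "soft_orbit d R"
proof -
  obtain Q where Q: "soft_flow d Q" "\<And>t. t \<ge> 0 \<Longrightarrow> Q (t + pi) = - Q t"
    using soft_flow_antiperiodic[OF assms] by blast
  have shift: "Q (t + real j * pi) = (-1) ^ j * Q t" if "t \<ge> 0" for t j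
  proof (induction j)
    case (Suc j)
    then show ?case using Q(2)[of "t + real j * pi"] that by (simp add: algebra_simps)
  qed simp
  define k where "k t = nat \<lceil>\<bar>t\<bar> / pi\<rceil>" for t :: real
  have k: "t + real (k t) * pi \<ge> 0" for t
  proof -
    have "\<bar>t\<bar> / pi \<le> real (k t)" unfolding k_def by linarith
    then have "\<bar>t\<bar> \<le> real (k t) * pi" by (simp add: divide_simps)
    then show ?thesis by linarith
  qed
  define R where "R t = (-1) ^ k t * Q (t + real (k t) * pi)" for t
  \<comment> \<open>The value does not depend on the number of half periods, which permits one fixed
    \<open>m\<close> in a neighbourhood of \<open>t\<close> below.\<close>
  have R: "R t = (-1) ^ m * Q (t + real m * pi)" if "t + real m * pi \<ge> 0" for t m
  proof -
    have "Q (t + real (m + k t) * pi) = (-1) ^ k t * Q (t + real m * pi)"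
      using shift[OF that, of "k t"] by (simp add: algebra_simps)
    moreover have "Q (t + real (m + k t) * pi) = (-1) ^ m * Q (t + real (k t) * pi)"
      using shift[OF k, of t m] by (simp add: algebra_simps)
    ultimately have "(-1) ^ k t * Q (t + real m * pi) = (-1) ^ m * Q (t + real (k t) * pi)" by simp
    then show ?thesis unfolding R_def
      by (cases "even m"; cases "even (k t)") (auto simp: minus_equation_iff)
  qed
  have "(R has_vector_derivative soft_field d t (R t)) (at t)" for t
  proof -
    \<comment> \<open>One half period more than \<open>k t\<close> makes the shifted time strictly
      positive, where the derivative within \<open>{0..}\<close> is two-sided.\<close>
    define m where "m = Suc (k t)"
    have m: "t + real m * pi > 0" 
      unfolding m_def of_nat_Suc distrib_right using k[of t] pi_gt_zero by linarith
    have "(Q has_vector_derivative soft_field d (t + real m * pi) (Q (t + real m * pi))) (at (t + real m * pi) within {0..})"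
      using Q(1) m by (auto simp: soft_flow_def)
    moreover have "at (t + real m * pi) within {0..} = at (t + real m * pi)"
      using m by (intro at_within_interior) (auto simp: interior_real_atLeast)
    ultimately have "(Q has_vector_derivative soft_field d (t + real m * pi) (Q (t + real m * pi))) (at (t + real m * pi))"
      by simp
    then have "(Q \<circ> (\<lambda>t. t + real m * pi) has_vector_derivative
        1 *\<^sub>R soft_field d (t + real m * pi) (Q (t + real m * pi))) (at t)"
      by (intro vector_diff_chain_at) (auto intro!: derivative_eq_intros)
    then have "((\<lambda>t. (-1) ^ m * Q (t + real m * pi)) has_vector_derivative
        (-1) ^ m * soft_field d (t + real m * pi) (Q (t + real m * pi))) (at t)"
      by (auto intro!: has_vector_derivative_mult_right simp: o_def)
    moreover have "(-1) ^ m * soft_field d (t + real m * pi) (Q (t + real m * pi)) = soft_field d t (R t)"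
    proof -
      have "Q (t + real m * pi) = (-1) ^ m * R t" using R[of t m] m by simp
      then show ?thesis using soft_field_shift[of d t m "R t"] by simp
    qed
    ultimately have "((\<lambda>t. (-1) ^ m * Q (t + real m * pi)) has_vector_derivative soft_field d t (R t)) (at t)"
      by simp
    then show ?thesis
      by (rule has_vector_derivative_transform_within_open[where S = "{- real m * pi<..}"])
        (use m in \<open>auto simp: R[symmetric]\<close>)
  qed
  moreover have "R (t + pi) = - R t" for t
    using R[of "t + pi" "k t"] R[of t "k t"] k[of t] Q(2)[of "t + real (k t) * pi"] pi_ge_zero
    by (simp add: algebra_simps)
  ultimately show ?thesis using that[of R] by (auto simp: soft_orbit_def)
qed

text \<open>\<open>G\<close> and \<open>- Q\<close> are the complex conjugates of the positions of evader and pursuer. In the rotating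
  frame, the real and imaginary parts of the conjugate of the distance vector are its components along
  the tangent and along the inner normal at the evader.\<close>
definition view :: "(real \<Rightarrow> complex) \<Rightarrow> real \<Rightarrow> complex" where
  "view Q t = cis t * (Q t + G t)"

section \<open>The regularised equation in the rotating frame\<close>

lemma norm_view: "norm (view Q t) = norm (Q t + G t)"
  by (simp add: view_def norm_mult)

lemma view_periodic: "soft_orbit d Q \<Longrightarrow> view Q (t + pi) = view Q t"
  by (simp add: view_def soft_orbit_def G_antiperiodic flip: cis_mult)
     (simp add: right_diff_distrib distrib_left)

text \<open>The rotation by \<open>cis t\<close> makes the forcing term real and adds i times the
  view; the result is the complex pursuit equation with \<open>soft_dir d\<close> in place of
  \<open>sgn\<close>.\<close>

lemma soft_orbit_view_deriv:
  assumes "soft_orbit d Q"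
  shows "(view Q has_vector_derivative
    of_real (g t) - (n * g t) *\<^sub>R soft_dir d (view Q t) + \<i> * view Q t) (at t)"
proof -
  have c: "(cis has_vector_derivative \<i> * cis t) (at t)"
    unfolding has_vector_derivative_def by (rule has_derivative_cis[OF has_derivative_ident])
  have "((\<lambda>t. Q t + G t) has_vector_derivative soft_field d t (Q t) + g t *\<^sub>R cis (- t)) (at t)"
    using assms by (auto simp: soft_orbit_def intro!: has_vector_derivative_add G_deriv)
  from has_vector_derivative_mult[OF c this]
  have "(view Q has_vector_derivative
    cis t * (soft_field d t (Q t) + g t *\<^sub>R cis (- t)) + \<i> * cis t * (Q t + G t)) (at t)"
    unfolding view_def by simp
  moreover have "cis t * soft_field d t (Q t) = - ((n * g t) *\<^sub>R soft_dir d (view Q t))"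
    by (simp add: soft_field_def soft_dir_def view_def norm_mult)
  moreover have "cis t * (g t *\<^sub>R cis (- t)) = of_real (g t)"
    by (simp add: cis_mult scaleR_conv_of_real)
  ultimately show ?thesis
    by (simp only: distrib_left view_def[of Q t] mult.assoc) (simp add: add.commute)
qed

lemma soft_orbit_deriv_Re:
  assumes "soft_orbit d Q"
  shows "((\<lambda>t. Re (view Q t)) has_real_derivative
    g t - n * g t * (Re (view Q t) / max (norm (view Q t)) d) - Im (view Q t)) (at t)"
  using bounded_linear.has_vector_derivative[OF bounded_linear_Re soft_orbit_view_deriv[OF assms, of t]]
  by (simp add: has_real_derivative_iff_has_vector_derivative soft_dir_def)

lemma soft_orbit_deriv_Im:
  assumes "soft_orbit d Q"
  shows "((\<lambda>t. Im (view Q t)) has_real_derivative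
    Re (view Q t) - n * g t * (Im (view Q t) / max (norm (view Q t)) d)) (at t)"
  using bounded_linear.has_vector_derivative[OF bounded_linear_Im soft_orbit_view_deriv[OF assms, of t]]
  by (simp add: has_real_derivative_iff_has_vector_derivative soft_dir_def)

lemma soft_orbit_cont: "soft_orbit d Q \<Longrightarrow> continuous_on S Q"
  unfolding soft_orbit_def by (meson continuous_at_imp_continuous_on has_vector_derivative_continuous)

text \<open>At a maximum of \<open>norm (Q t)\<close> the derivative vanishes, so \<open>Q\<close>
  is orthogonal to \<open>Q + G\<close> there, and Cauchy--Schwarz gives
  \<open>norm (Q t) <= norm (G t)\<close> at that time.\<close>

lemma soft_orbit_bound:
  assumes "d > 0" "soft_orbit d Q" "\<And>t. norm (G t) \<le> M"
  shows "norm (Q t) \<le> M"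
proof -
  have c: "continuous_on UNIV (\<lambda>t. - (Q t \<bullet> Q t))" by (intro continuous_intros soft_orbit_cont[OF assms(2)])
  have p: "- (Q (t + pi) \<bullet> Q (t + pi)) = - (Q t \<bullet> Q t)" for t
    using assms(2) by (simp add: soft_orbit_def)
  obtain t0 where t0: "\<And>t. - (Q t0 \<bullet> Q t0) \<le> - (Q t \<bullet> Q t)"
    using periodic_attains_inf[OF c p pi_gt_zero] by blast
  have "((\<lambda>t. - (Q t \<bullet> Q t)) has_real_derivative - (2 * (Q t0 \<bullet> soft_field d t0 (Q t0)))) (at t0)"
    using assms(2) by (intro DERIV_minus has_real_derivative_inner_self) (auto simp: soft_orbit_def)
  then have "- (2 * (Q t0 \<bullet> soft_field d t0 (Q t0))) = 0"
    by (rule DERIV_local_min[where d=1]) (simp, intro allI impI t0)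
  then have "Q t0 \<bullet> (Q t0 + G t0) = 0"
    using assms(1) n_pos g_pos[of t0] by (auto simp: soft_field_def soft_dir_def max_def split: if_splits)
  then have "norm (Q t0) * norm (Q t0) \<le> norm (Q t0) * norm (G t0)"
    using norm_cauchy_schwarz[of "Q t0" "- G t0"]
    by (simp add: inner_add_right dot_square_norm power2_eq_square)
  then have "norm (Q t0) \<le> norm (G t0)"
    by (cases "Q t0 = 0") auto
  then have "norm (Q t0) \<le> M" using assms(3)[of t0] by simp
  moreover have "norm (Q t) \<le> norm (Q t0)" using t0[of t] by (simp add: dot_square_norm)
  ultimately show ?thesis by simp
qed

text \<open>At a minimum of the component of the pursuer's position along the inner normal \<open>\<i> cis s\<close> the
  velocity has no component along it, so the evader has the same component there.\<close>
lemma soft_orbit_Im_nonneg: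
  assumes "d > 0" "soft_orbit d Q"
  shows "Im (view Q s) \<ge> 0"
proof -
  define f where "f t = Im (cis s * Q t)" for t
  have c: "continuous_on UNIV f" unfolding f_def by (intro continuous_intros soft_orbit_cont[OF assms(2)])
  \<comment> \<open>A shift by \<open>pi\<close> flips the sign of \<open>f\<close>, so the period
    to work with is \<open>2 * pi\<close>.\<close>
  have "Q (t + 2 * pi) = Q t" for t
  proof -
    have "Q (t + pi) = - Q t" "Q (t + pi + pi) = - Q (t + pi)"
      using assms(2) unfolding soft_orbit_def by blast+
    moreover have "t + 2 * pi = t + pi + pi" by simp
    ultimately show ?thesis by (metis minus_minus)
  qed
  then have p: "f (t + 2 * pi) = f t" for t by (simp add: f_def)
  obtain t0 where t0: "\<And>t. f t0 \<le> f t"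
    by (rule periodic_attains_inf[OF c p]) auto
  have "((\<lambda>t. cis s * Q t) has_vector_derivative cis s * soft_field d t0 (Q t0)) (at t0)"
    using assms(2) by (auto simp: soft_orbit_def intro!: has_vector_derivative_mult_right)
  from bounded_linear.has_vector_derivative[OF bounded_linear_Im this]
  have "(f has_real_derivative Im (cis s * soft_field d t0 (Q t0))) (at t0)"
    unfolding f_def has_real_derivative_iff_has_vector_derivative .
  then have "Im (cis s * soft_field d t0 (Q t0)) = 0"
    by (rule DERIV_local_min[where d=1]) (simp, intro allI impI t0)
  moreover define \<kappa> where "\<kappa> = n * g t0 / max (norm (Q t0 + G t0)) d"
  have "cis s * soft_field d t0 (Q t0) = - (\<kappa> *\<^sub>R (cis s * (Q t0 + G t0)))"
    unfolding soft_field_def soft_dir_def \<kappa>_def mult_minus_right mult_scaleR_right scaleR_scaleR by simp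
  moreover have "\<kappa> > 0" using assms(1) n_pos g_pos[of t0] 
    unfolding \<kappa>_def by (intro divide_pos_pos mult_pos_pos) (auto simp: less_max_iff_disj)
  ultimately have "\<kappa> * Im (cis s * (Q t0 + G t0)) = 0" "\<kappa> \<noteq> 0" by simp_all
  then have "Im (cis s * (Q t0 + G t0)) = 0" by (simp only: mult_eq_0_iff) simp
  then have "f t0 = - Im (cis s * G t0)" by (simp add: f_def distrib_left)
  then show ?thesis
    using t0[of s] G_support[of s t0] by (simp add: f_def view_def distrib_left)
qed

text \<open>A zero of the nonnegative imaginary part is a minimum; the derivative there equals the
  real part, which then vanishes as well.\<close>

lemma soft_orbit_Im_pos:
  assumes "d > 0" "soft_orbit d Q" "view Q s \<noteq> 0"
  shows "Im (view Q s) > 0"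
proof (rule ccontr)
  assume "\<not> Im (view Q s) > 0"
  then have y: "Im (view Q s) = 0" using soft_orbit_Im_nonneg[OF assms(1,2), of s] by simp
  have "Re (view Q s) - n * g s * (Im (view Q s) / max (norm (view Q s)) d) = 0"
    by (rule DERIV_local_min[OF soft_orbit_deriv_Im[OF assms(2)], of 1])
      (simp, simp add: y soft_orbit_Im_nonneg[OF assms(1,2)])
  then show False using y assms(3) by (simp add: complex_eq_iff)
qed

end

subsection \<open>Exclusion of near collisions\<close>

text \<open>The difference has derivative \<open>u * sin u\<close>. The inequality will turn a bound
  on the slope \<open>y / x\<close> into a bound on the angle.\<close>

lemma mult_cos_le_sin:
  fixes u :: real
  assumes "0 \<le> u" "u \<le> pi"
  shows "u * cos u \<le> sin u"
proof -
  have "sin 0 - 0 * cos 0 \<le> sin u - u * cos u"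
  proof (rule DERIV_nonneg_imp_nondecreasing[OF assms(1)])
    fix v assume v: "0 \<le> v" "v \<le> u"
    have "((\<lambda>u. sin u - u * cos u) has_real_derivative v * sin v) (at v)"
      by (auto intro!: derivative_eq_intros)
    then show "\<exists>y. ((\<lambda>u. sin u - u * cos u) has_real_derivative y) (at v) \<and> 0 \<le> y"
      using v assms sin_ge_zero by (intro exI[of _ "v * sin v"]) auto
  qed
  then show ?thesis by simp
qed

lemma nondecreasing_of_deriv:
  fixes f f' :: "real \<Rightarrow> real"
  assumes "a \<le> b" "\<And>t. \<lbrakk>a \<le> t; t \<le> b\<rbrakk> \<Longrightarrow> (f has_real_derivative f' t) (at t)"
    "\<And>t. \<lbrakk>a \<le> t; t \<le> b\<rbrakk> \<Longrightarrow> f' t \<ge> 0"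
  shows "f a \<le> f b"
  using DERIV_nonneg_imp_nondecreasing[OF assms(1), of f] assms(2,3) by blast

text \<open>One orbit of the regularised equation. The bounds \<open>g0\<close>, \<open>g1\<close>
  and \<open>R\<close> can be chosen without regard to \<open>d\<close>, so estimates in terms of
  them and \<open>n\<close> are uniform in \<open>d\<close>.\<close>

locale soft_pursuit = closed_pursuit +
  fixes d :: real and Q :: "real \<Rightarrow> complex" and g0 g1 R :: real
  assumes d_pos: "d > 0" and orbit: "soft_orbit d Q"
    and g0: "0 < g0" "\<And>t. g0 \<le> g t" and g1: "\<And>t. g t \<le> g1"
    and view_le: "\<And>t. norm (view Q t) \<le> R"
begin

section \<open>The two components of the view and their growth\<close>

definition x where "x t = Re (view Q t)"
definition y where "y t = Im (view Q t)"
definition r where "r t = norm (view Q t)"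
text \<open>The pull of the pursuer on the view is \<open>- \<kappa> t\<close> times the view
  itself.\<close>

definition \<kappa> where "\<kappa> t = n * g t / max (r t) d"

lemma r_eq: "r t = sqrt ((x t)\<^sup>2 + (y t)\<^sup>2)"
  by (simp add: r_def x_def y_def cmod_def)

lemma r_bounds: "0 \<le> r t" "r t \<le> R" "\<bar>x t\<bar> \<le> r t" "\<bar>y t\<bar> \<le> r t" "r t \<le> \<bar>x t\<bar> + \<bar>y t\<bar>"
  using view_le[of t] by (auto simp: r_def x_def y_def abs_Re_le_cmod abs_Im_le_cmod cmod_le)

lemma \<kappa>_pos: "0 < \<kappa> t"
  unfolding \<kappa>_def using n_pos g_pos[of t] d_pos
  by (intro divide_pos_pos mult_pos_pos) (auto simp: less_max_iff_disj)

lemma \<kappa>_r: "\<kappa> t * r t \<le> n * g t"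
proof -
  have "r t \<le> max (r t) d" "0 < max (r t) d" using d_pos by auto
  then have "(n * g t) * (r t / max (r t) d) \<le> (n * g t) * 1"
    using n_pos g_pos[of t] by (intro mult_left_mono) auto
  then show ?thesis by (simp add: \<kappa>_def)
qed

lemma \<kappa>_x: "\<kappa> t * x t \<le> n * g t"
  by (rule order_trans[OF mult_left_mono \<kappa>_r]) (use r_bounds(3)[of t] \<kappa>_pos[of t] in auto)

lemma y_nonneg: "0 \<le> y t"
  unfolding y_def by (rule soft_orbit_Im_nonneg[OF d_pos orbit])

lemma y_pos: "r t > 0 \<Longrightarrow> y t > 0"
  unfolding y_def r_def by (rule soft_orbit_Im_pos[OF d_pos orbit]) auto

lemma r_periodic: "r (t + pi) = r t"
  by (simp add: r_def view_periodic[OF orbit])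

lemma x_deriv: "(x has_real_derivative g t - \<kappa> t * x t - y t) (at t)"
  using soft_orbit_deriv_Re[OF orbit, of t]
  by (simp add: x_def[abs_def] y_def r_def \<kappa>_def)

lemma y_deriv: "(y has_real_derivative x t - \<kappa> t * y t) (at t)"
  using soft_orbit_deriv_Im[OF orbit, of t]
  by (simp add: x_def y_def[abs_def] r_def \<kappa>_def)

lemma r_cont: "continuous_on S r"
  unfolding r_eq using DERIV_isCont[OF x_deriv] DERIV_isCont[OF y_deriv]
  by (intro continuous_at_imp_continuous_on ballI continuous_intros)

text \<open>The view moves at speed at most \<open>g1\<close> due to the evader,
  \<open>n * g1 <= g1\<close> due to the pursuer and \<open>R\<close> due to the rotation of the
  frame.\<close>

lemma r_growth:
  assumes "a \<le> b"
  shows "r b \<le> r a + (2 * g1 + R) * (b - a)"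
proof (cases "a = b")
  case False
  then have ab: "a < b" using assms by simp
  define w' where "w' t = of_real (g t) - (n * g t) *\<^sub>R soft_dir d (view Q t) + \<i> * view Q t" for t
  have w': "(view Q has_vector_derivative w' t) (at t)" for t
    unfolding w'_def by (rule soft_orbit_view_deriv[OF orbit])
  have "norm (view Q b - view Q a) \<le> (2 * g1 + R) * b - (2 * g1 + R) * a"
  proof (rule differentiable_bound_general[OF ab, where f'=w' and \<phi>="\<lambda>t. (2 * g1 + R) * t" and \<phi>'="\<lambda>_. 2 * g1 + R"])
    show "continuous_on {a..b} (view Q)"
      using w' by (meson continuous_at_imp_continuous_on has_vector_derivative_continuous)
    fix t
    have "norm (w' t) \<le> norm (complex_of_real (g t)) + norm ((n * g t) *\<^sub>R soft_dir d (view Q t)) + norm (\<i> * view Q t)"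
      unfolding w'_def using norm_triangle_ineq4[of "complex_of_real (g t)" "(n * g t) *\<^sub>R soft_dir d (view Q t)"]
      by (intro order_trans[OF norm_triangle_ineq]) linarith
    also have "\<dots> \<le> g t + 1 * g t * 1 + R"
      using g_pos[of t] n_pos n_less_1 view_le[of t] norm_soft_dir_le[OF d_pos, of "view Q t"]
      by (intro add_mono) (auto simp: norm_mult intro!: mult_mono mult_le_one)
    also have "\<dots> \<le> 2 * g1 + R" using g1[of t] by simp
    finally show "norm (w' t) \<le> 2 * g1 + R" .
    show "(view Q has_vector_derivative w' t) (at t)" by (rule w')
    show "((\<lambda>t. (2 * g1 + R) * t) has_vector_derivative 2 * g1 + R) (at t)"
      unfolding has_real_derivative_iff_has_vector_derivative[symmetric]
      by (auto intro!: derivative_eq_intros)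
  qed (intro continuous_intros)
  then show ?thesis using norm_triangle_ineq2[of "view Q b" "view Q a"]
    by (simp add: r_def right_diff_distrib)
qed simp

text \<open>The evader gains at least \<open>(1 - n) * g0\<close> along the tangent; the rotation
  takes away \<open>y t <= r t\<close>, at most half of that.\<close>

lemma close_pass_x_deriv:
  assumes "r t \<le> (1 - n) * g0 / 2"
  shows "(1 - n) * g0 / 2 \<le> g t - \<kappa> t * x t - y t"
proof -
  have "(1 - n) * g0 \<le> (1 - n) * g t" using n_less_1 g0(2)[of t] by (intro mult_left_mono) auto
  moreover have "(1 - n) * g t = g t - n * g t" by (simp add: left_diff_distrib)
  ultimately show ?thesis using \<kappa>_x[of t] r_bounds(4)[of t] assms by linarith
qed

text \<open>At a passage close to the evader, \<open>x\<close> increases at a definite rate and \<open>y' \<le> x\<close>. Shortly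
  afterwards the evader is therefore seen in a direction turned from the tangent at time \<open>t0\<close> by a definite angle.\<close>
context
  fixes c s \<delta> t0 :: real
  assumes c_def: "c = (1 - n) * g0 / 2"
    and s: "0 < s" "s \<le> 1" "(2 * g1 + R) * s \<le> c / 2"
    and \<delta>: "\<delta> \<le> c / 2" "\<delta> \<le> c * s\<^sup>2 / 4"
    and close: "r t0 \<le> \<delta>"
begin

lemma c_pos: "c > 0" using n_less_1 g0(1) by (simp add: c_def)

text \<open>Starting below \<open>c / 2\<close>, the distance grows by at most \<open>c / 2\<close>
  within time \<open>s\<close> and so stays in the range of
  \<open>close_pass_x_deriv\<close>.\<close>

lemma pass_x_deriv:
  assumes "t0 \<le> t" "t \<le> t0 + s"
  shows "c \<le> g t - \<kappa> t * x t - y t"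
proof -
  have "0 \<le> 2 * g1 + R" using g_pos[of 0] g1[of 0] r_bounds(1,2)[of 0] by linarith
  then have "(2 * g1 + R) * (t - t0) \<le> (2 * g1 + R) * s" using assms by (intro mult_left_mono) auto
  then have "r t \<le> c" using r_growth[OF assms(1)] s(3) \<delta>(1) close by linarith
  then show ?thesis using close_pass_x_deriv unfolding c_def by blast
qed

lemma pass_x_growth:
  assumes "t0 \<le> t" "t \<le> t0 + s"
  shows "x t \<ge> c * (t - t0) - \<delta>"
proof -
  have "x t0 - c * t0 \<le> x t - c * t"
  proof (rule nondecreasing_of_deriv[OF assms(1), where f = "\<lambda>t. x t - c * t"])
    fix u assume "t0 \<le> u" "u \<le> t"
    then show "g u - \<kappa> u * x u - y u - c \<ge> 0" using pass_x_deriv[of u] assms by simp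
    show "((\<lambda>t. x t - c * t) has_real_derivative g u - \<kappa> u * x u - y u - c) (at u)"
      by (auto intro!: derivative_eq_intros x_deriv)
  qed
  then show ?thesis using r_bounds(3)[of t0] close by (simp add: algebra_simps abs_le_iff)
qed

text \<open>The first half of the window contributes \<open>c * s / 2\<close>; of this at most
  \<open>\<delta> <= c * s^2 / 4 <= c * s / 4\<close> is lost.\<close>

lemma pass_x_late:
  assumes "t0 + s / 2 \<le> t" "t \<le> t0 + s"
  shows "x t \<ge> c * s / 4"
proof -
  have "c * (s / 2) \<le> c * (t - t0)" using assms c_pos by (intro mult_left_mono) auto
  moreover have "c * s * s \<le> c * s * 1" using s c_pos by (intro mult_left_mono) auto
  ultimately show ?thesis
    using pass_x_growth[of t] assms s(1) \<delta>(2) by (simp add: power2_eq_square)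
qed

text \<open>Integration by parts: \<open>y' <= x\<close> and \<open>x' >= c\<close> bound the
  increase of \<open>y\<close> by \<open>s * x (t0 + s) - c * s^2 / 2\<close>, and
  \<open>y t0 <= \<delta>\<close> uses up half of the last term. Monotonicity of \<open>f\<close>
  expresses this.\<close>

lemma pass_y_upper: "y (t0 + s) \<le> s * x (t0 + s) - c * s\<^sup>2 / 4"
proof -
  define f where "f = (\<lambda>t. (t - t0) * x t - y t - c / 2 * (t - t0)\<^sup>2)"
  define f' where "f' = (\<lambda>t. (t - t0) * (g t - \<kappa> t * x t - y t - c) + \<kappa> t * y t)"
  have "f t0 \<le> f (t0 + s)"
  proof (rule nondecreasing_of_deriv[where f = f and f' = f'])
    fix t assume t: "t0 \<le> t" "t \<le> t0 + s"
    show "(f has_real_derivative f' t) (at t)"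
      unfolding f_def f'_def by (auto intro!: derivative_eq_intros x_deriv y_deriv simp: field_simps)
    show "f' t \<ge> 0" unfolding f'_def
      using t pass_x_deriv[OF t] y_nonneg[of t] \<kappa>_pos[of t] by (intro add_nonneg_nonneg mult_nonneg_nonneg) auto
  qed (use s in auto)
  then show ?thesis using r_bounds(4)[of t0] close \<delta>(2) by (simp add: f_def abs_le_iff)
qed

text \<open>On the second half of the window \<open>x\<close>, and with it \<open>r\<close>, is at
  least \<open>c * s / 4\<close>, so \<open>\<kappa>\<close> is at most \<open>k\<close> whatever
  \<open>d\<close> is. Then \<open>y' >= c * s / 4 - k * y\<close>, which is integrated with the
  factor \<open>exp (k * (t - b))\<close>.\<close>

lemma pass_y_lower:
  defines "k \<equiv> n * g1 / (c * s / 4)"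
  shows "y (t0 + s) \<ge> exp (- k * s / 2) * (c * s / 4) * s / 2"
proof -
  define b where "b = t0 + s"
  define A where "A = exp (- k * s / 2) * (c * s / 4)"
  have cs: "c * s / 4 > 0" using c_pos s by simp
  have k: "k \<ge> 0" unfolding k_def using cs n_pos g_pos[of 0] g1[of 0] by (intro divide_nonneg_pos mult_nonneg_nonneg) auto
  define f where "f = (\<lambda>t. y t * exp (k * (t - b)) - A * t)"
  define f' where "f' = (\<lambda>t. (x t - \<kappa> t * y t + k * y t) * exp (k * (t - b)) - A)"
  have "f (t0 + s / 2) \<le> f b"
  proof (rule nondecreasing_of_deriv[where f = f and f' = f'])
    fix t assume t: "t0 + s / 2 \<le> t" "t \<le> b"
    show "(f has_real_derivative f' t) (at t)"
      unfolding f_def f'_def by (auto intro!: derivative_eq_intros y_deriv simp: algebra_simps)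
    have xt: "x t \<ge> c * s / 4" using pass_x_late t by (simp add: b_def)
    then have rt: "r t \<ge> c * s / 4" using r_bounds(3)[of t] by simp
    have "\<kappa> t \<le> k" unfolding \<kappa>_def k_def
      using rt cs g1[of t] n_pos g_pos[of t] by (intro frac_le mult_left_mono) auto
    then have "c * s / 4 \<le> x t - \<kappa> t * y t + k * y t"
      using xt mult_right_mono[of "\<kappa> t" k "y t"] y_nonneg[of t] by linarith
    moreover have "exp (- k * s / 2) \<le> exp (k * (t - b))"
      using mult_left_mono[OF t(1) k] by (simp add: b_def algebra_simps)
    ultimately have "c * s / 4 * exp (- k * s / 2) \<le> (x t - \<kappa> t * y t + k * y t) * exp (k * (t - b))"
      using cs by (intro mult_mono) auto
    then show "f' t \<ge> 0" by (simp add: f'_def A_def mult.commute)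
  qed (use s in \<open>auto simp: b_def\<close>)
  then have "A * (s / 2) \<le> y b - y (t0 + s / 2) * exp (k * (t0 + s / 2 - b))"
    by (simp add: f_def b_def algebra_simps)
  also have "\<dots> \<le> y b" using y_nonneg by simp
  finally show ?thesis by (simp add: A_def b_def)
qed

end

text \<open>\<open>v t\<close> is the imaginary part of \<open>cis \<tau> * (Q t + G t)\<close>, a
  component in the frame frozen at time \<open>\<tau>\<close>. Where it is positive, the pull lowers
  it, and so does the evader's motion as long as \<open>sin (t - \<tau>) >= 0\<close>.\<close>

lemma cone_persists:
  assumes "a \<le> b" "\<tau> \<le> a" "b \<le> \<tau> + pi"
    and start: "y a * cos (a - \<tau>) \<le> x a * sin (a - \<tau>)"
  shows "y b * cos (b - \<tau>) \<le> x b * sin (b - \<tau>)"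
proof -
  define v where "v = (\<lambda>t. y t * cos (t - \<tau>) - x t * sin (t - \<tau>))"
  define v' where "v' = (\<lambda>t. - \<kappa> t * v t - g t * sin (t - \<tau>))"
  have "v b \<le> 0"
  proof (rule nonpos_forward_invariant[where v = v and v' = v'])
    fix t assume t: "t \<in> {a..b}"
    have "(v has_real_derivative v' t) (at t)"
      unfolding v_def v'_def by (auto intro!: derivative_eq_intros x_deriv y_deriv simp: algebra_simps)
    then show "(v has_real_derivative v' t) (at t within {a..b})"
      by (rule has_field_derivative_at_within)
    assume "v t > 0"
    moreover have "sin (t - \<tau>) \<ge> 0" using t assms by (intro sin_ge_zero) auto
    ultimately have "0 \<le> \<kappa> t * v t" "0 \<le> g t * sin (t - \<tau>)"
      using \<kappa>_pos[of t] g_pos[of t] by (auto intro: mult_nonneg_nonneg)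
    then show "v' t \<le> 0" by (simp add: v'_def)
  qed (use assms in \<open>auto simp: v_def\<close>)
  then show ?thesis by (simp add: v_def)
qed

text \<open>The argument of a nonzero view is at most \<open>\<theta>\<close>, so it keeps an angle
  of at least \<open>\<beta>\<close> from the negative real axis. Hence \<open>- x\<close> is at
  most \<open>y / sin \<beta>\<close>, while
  \<open>x - n * r >= x - \<bar>x\<bar> - y\<close>.\<close>

lemma cone_slope:
  assumes \<beta>: "0 < \<beta>" "\<beta> \<le> pi / 2" and \<theta>: "0 \<le> \<theta>" "\<theta> \<le> pi - \<beta>"
    and cone: "y t * cos \<theta> \<le> x t * sin \<theta>"
  shows "x t - n * r t \<ge> - (1 + 2 / sin \<beta>) * y t"
proof -
  have sb: "sin \<beta> > 0" using \<beta> pi_gt_zero by (intro sin_gt_zero) auto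
  have x: "- x t \<le> y t / sin \<beta>"
  proof (cases "x t \<ge> 0")
    case True
    then have "- x t \<le> 0" by simp
    also have "0 \<le> y t / sin \<beta>" using y_nonneg sb by (intro divide_nonneg_pos)
    finally show ?thesis .
  next
    case False
    have s: "sin \<theta> \<ge> 0" using \<theta> \<beta> by (intro sin_ge_zero) auto
    \<comment> \<open>For negative \<open>x t\<close> the cone condition excludes acute
      \<open>\<theta>\<close>; from \<open>pi / 2\<close> to \<open>pi - \<beta>\<close> the sine is
      at least \<open>sin \<beta>\<close>.\<close>
    have "\<theta> \<ge> pi / 2"
    proof (rule ccontr)
      assume "\<not> \<theta> \<ge> pi / 2"
      then have "cos \<theta> > 0" using \<theta> by (intro cos_gt_zero_pi) auto
      then have "0 \<le> x t * sin \<theta>" using cone y_nonneg[of t] by (meson mult_nonneg_nonneg less_imp_le order_trans)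
      then have "sin \<theta> = 0" using False s by (simp add: zero_le_mult_iff)
      then have "\<theta> = 0" using sin_gt_zero[of \<theta>] \<theta> \<beta> by force
      then have "y t = 0" using cone y_nonneg[of t] by simp
      then show False using False y_pos[of t] r_bounds(3)[of t] by auto
    qed
    then have "sin (pi - \<theta>) \<ge> sin \<beta>" using \<theta> \<beta> by (intro sin_monotone_2pi_le) auto
    then have "sin \<theta> \<ge> sin \<beta>" by simp
    then have "- x t * sin \<beta> \<le> - x t * sin \<theta>" using False by (intro mult_left_mono) auto
    also have "\<dots> \<le> y t * - cos \<theta>" using cone by simp
    also have "\<dots> \<le> y t * 1" using cos_ge_minus_one[of \<theta>] y_nonneg[of t] by (intro mult_left_mono) auto
    finally show ?thesis using sb by (simp add: pos_le_divide_eq)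
  qed
  have "n * r t \<le> n * (\<bar>x t\<bar> + y t)"
    using r_bounds(5)[of t] y_nonneg[of t] n_pos by (intro mult_left_mono) auto
  also have "\<dots> = n * \<bar>x t\<bar> + n * y t" by (simp add: distrib_left)
  also have "\<dots> \<le> 1 * \<bar>x t\<bar> + 1 * y t"
    using n_less_1 y_nonneg[of t] by (intro add_mono mult_right_mono) auto
  finally have "x t - n * r t \<ge> x t - \<bar>x t\<bar> - y t" by simp
  moreover have "x t - \<bar>x t\<bar> \<ge> - 2 * (y t / sin \<beta>)"
    using x divide_nonneg_pos[OF y_nonneg[of t] sb] by (simp add: abs_if)
  moreover have "- (1 + 2 / sin \<beta>) * y t = - 2 * (y t / sin \<beta>) - y t" by (simp add: algebra_simps)
  ultimately show ?thesis by linarith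
qed

text \<open>For an evader moving along a straight line, \<open>y powr (1 - n) * (r + x) powr n\<close> is a first
  integral of the pursuit.\<close>
definition L where "L t = (1 - n) * ln (y t) + n * ln (r t + x t)"

lemma r_plus_x_pos: "r t > 0 \<Longrightarrow> r t + x t > 0"
proof -
  assume "r t > 0"
  then have "y t > 0" by (rule y_pos)
  then have "\<bar>x t\<bar> < r t" unfolding r_eq by (intro real_less_rsqrt) (simp add: power2_abs)
  then show ?thesis by linarith
qed

text \<open>\<open>n * g / r - \<kappa>\<close> is the effect of the regularisation and vanishes for
  \<open>r >= d\<close>; \<open>(x - n * r) / y\<close> comes from the rotation of the frame
  alone.\<close>

lemma L_deriv:
  assumes "r t > 0"
  shows "(L has_real_derivative n * g t / r t - \<kappa> t + (x t - n * r t) / y t) (at t)"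
proof -
  have y: "y t > 0" and rx: "r t + x t > 0" using assms y_pos r_plus_x_pos by auto
  have r2: "(r t)\<^sup>2 = (x t)\<^sup>2 + (y t)\<^sup>2" by (simp add: r_eq)
  have pos: "(x t)\<^sup>2 + (y t)\<^sup>2 > 0" using assms r2 by (metis zero_less_power)
  have "((\<lambda>t. (x t)\<^sup>2 + (y t)\<^sup>2) has_real_derivative
      2 * x t * (g t - \<kappa> t * x t - y t) + 2 * y t * (x t - \<kappa> t * y t)) (at t)"
    by (auto intro!: derivative_eq_intros x_deriv y_deriv)
  moreover have "2 * x t * (g t - \<kappa> t * x t - y t) + 2 * y t * (x t - \<kappa> t * y t)
      = 2 * (g t * x t - \<kappa> t * (r t)\<^sup>2)"
    unfolding r2 by (simp add: algebra_simps power2_eq_square)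
  ultimately have "((\<lambda>t. (x t)\<^sup>2 + (y t)\<^sup>2) has_real_derivative 2 * (g t * x t - \<kappa> t * (r t)\<^sup>2)) (at t)"
    by (simp only:)
  from DERIV_chain2[OF DERIV_real_sqrt[OF pos] this]
  have "(r has_real_derivative inverse (r t) / 2 * (2 * (g t * x t - \<kappa> t * (r t)\<^sup>2))) (at t)"
    by (simp only: r_eq[symmetric])
  moreover have "inverse (r t) / 2 * (2 * (g t * x t - \<kappa> t * (r t)\<^sup>2)) = (g t * x t - \<kappa> t * (r t)\<^sup>2) / r t"
    using assms by (simp add: field_simps)
  ultimately have "(r has_real_derivative (g t * x t - \<kappa> t * (r t)\<^sup>2) / r t) (at t)" by (simp only:)
  moreover have "(g t * x t - \<kappa> t * (r t)\<^sup>2) / r t = g t * x t / r t - \<kappa> t * r t"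
    using assms by (simp add: field_simps power2_eq_square)
  ultimately have r': "(r has_real_derivative g t * x t / r t - \<kappa> t * r t) (at t)" by (simp only:)
  have "(L has_real_derivative (1 - n) * ((x t - \<kappa> t * y t) / y t)
      + n * ((g t * x t / r t - \<kappa> t * r t + (g t - \<kappa> t * x t - y t)) / (r t + x t))) (at t)"
    unfolding L_def using y rx
    by (auto intro!: derivative_eq_intros r' x_deriv y_deriv simp: divide_inverse mult.commute)
  moreover have "(x t - \<kappa> t * y t) / y t = x t / y t - \<kappa> t" using y by (simp add: field_simps)
  moreover have "(g t * x t / r t - \<kappa> t * r t + (g t - \<kappa> t * x t - y t)) / (r t + x t)
      = g t / r t - \<kappa> t - (r t - x t) / y t"
  proof -
    \<comment> \<open>From \<open>y^2 = (r + x) * (r - x)\<close>; this brings the rotation terms to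
      the common denominator \<open>y\<close>.\<close>
    have "y t / (r t + x t) = (r t - x t) / y t"
      using y rx r2 by (simp add: frac_eq_eq power2_eq_square algebra_simps)
    moreover have "g t * x t / r t - \<kappa> t * r t + (g t - \<kappa> t * x t - y t)
        = (g t / r t - \<kappa> t) * (r t + x t) - y t"
      using assms by (simp add: field_simps)
    moreover have "((g t / r t - \<kappa> t) * (r t + x t) - y t) / (r t + x t)
        = g t / r t - \<kappa> t - y t / (r t + x t)"
      using rx by (simp add: diff_divide_distrib)
    ultimately show ?thesis by (simp only:)
  qed
  ultimately have "(L has_real_derivative (1 - n) * (x t / y t - \<kappa> t)
      + n * (g t / r t - \<kappa> t - (r t - x t) / y t)) (at t)"
    by (simp only:)
  moreover have "(1 - n) * (x t / y t - \<kappa> t) + n * (g t / r t - \<kappa> t - (r t - x t) / y t)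
      = n * g t / r t - \<kappa> t + (x t - n * r t) / y t"
    by (simp add: algebra_simps diff_divide_distrib)
  ultimately show ?thesis by (simp only:)
qed

text \<open>\<open>\<kappa> <= n * g / r\<close> holds on both sides of \<open>r = d\<close>, so the
  regularisation can only raise \<open>L\<close>; the slope hypothesis bounds the rotation
  term.\<close>

lemma L_growth:
  assumes "a \<le> b"
    and pos: "\<And>t. \<lbrakk>a \<le> t; t \<le> b\<rbrakk> \<Longrightarrow> r t > 0"
    and slope: "\<And>t. \<lbrakk>a \<le> t; t \<le> b\<rbrakk> \<Longrightarrow> x t - n * r t \<ge> - C * y t"
  shows "L a - C * (b - a) \<le> L b"
proof -
  have "L a + C * a \<le> L b + C * b"
  proof (rule nondecreasing_of_deriv[OF assms(1), where f = "\<lambda>t. L t + C * t"])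
    fix t assume t: "a \<le> t" "t \<le> b"
    show "((\<lambda>t. L t + C * t) has_real_derivative n * g t / r t - \<kappa> t + (x t - n * r t) / y t + C) (at t)"
      by (auto intro!: derivative_eq_intros L_deriv pos t)
    have "\<kappa> t \<le> n * g t / r t"
      unfolding \<kappa>_def using pos[OF t] n_pos g_pos[of t] by (intro divide_left_mono) auto
    moreover have "(x t - n * r t) / y t \<ge> - C"
      using slope[OF t] y_pos[OF pos[OF t]] by (simp add: pos_le_divide_eq)
    ultimately show "n * g t / r t - \<kappa> t + (x t - n * r t) / y t + C \<ge> 0" by simp
  qed
  then show ?thesis by (simp add: algebra_simps)
qed

text \<open>\<open>exp (L t)\<close> is the weighted geometric mean of \<open>y t\<close> and
  \<open>r t + x t\<close>, and both are at most \<open>2 * r t\<close>.\<close>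

lemma exp_L_le:
  assumes "r t > 0"
  shows "exp (L t) \<le> 2 * r t"
proof -
  have "ln (y t) \<le> ln (2 * r t)"
    using y_pos[OF assms] r_bounds(4)[of t] assms by (subst ln_le_cancel_iff) auto
  moreover have "ln (r t + x t) \<le> ln (2 * r t)"
    using r_plus_x_pos[OF assms] r_bounds(3)[of t] assms by (subst ln_le_cancel_iff) auto
  ultimately have "L t \<le> (1 - n) * ln (2 * r t) + n * ln (2 * r t)"
    unfolding L_def using n_pos n_less_1 by (intro add_mono mult_left_mono) auto
  also have "\<dots> = ln (2 * r t)" by (simp add: algebra_simps)
  finally show ?thesis using assms by (simp add: ln_ge_iff)
qed

text \<open>The derivative of \<open>L\<close> is available only for \<open>r > 0\<close>, hence a
  continuity argument: up to the first time with \<open>r = \<epsilon>\<close> the distance is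
  positive, and the growth of \<open>L\<close> then gives the contradiction
  \<open>r >= 2 * \<epsilon>\<close> at that time.\<close>

lemma r_lower_bound:
  assumes "a \<le> b" "b \<le> a + pi" "C \<ge> 0" "r a > 0" "l \<le> L a"
    and slope: "\<And>t. \<lbrakk>a \<le> t; t \<le> b\<rbrakk> \<Longrightarrow> x t - n * r t \<ge> - C * y t"
  shows "r b \<ge> exp (l - C * pi) / 4"
proof (rule ccontr)
  define \<epsilon> where "\<epsilon> = exp (l - C * pi) / 4"
  have \<epsilon>: "\<epsilon> > 0" by (simp add: \<epsilon>_def)
  have *: "r t \<ge> 2 * \<epsilon>" if "a \<le> t" "t \<le> b" "\<And>u. \<lbrakk>a \<le> u; u \<le> t\<rbrakk> \<Longrightarrow> r u > 0" for t
  proof -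
    have "L a - C * (t - a) \<le> L t" using that slope by (intro L_growth) auto
    moreover have "C * (t - a) \<le> C * pi" using that assms by (intro mult_left_mono) auto
    ultimately have "exp (l - C * pi) \<le> exp (L t)" using assms(5) by simp
    also have "\<dots> \<le> 2 * r t" using that by (intro exp_L_le) auto
    finally show ?thesis by (simp add: \<epsilon>_def)
  qed
  assume "\<not> r b \<ge> exp (l - C * pi) / 4"
  then have rb: "r b < \<epsilon>" by (simp add: \<epsilon>_def)
  have ra: "r a \<ge> 2 * \<epsilon>" using *[of a] assms by force
  define S where "S = {t \<in> {a..b}. r t = \<epsilon>}"
  have hit: "\<exists>u\<ge>a. u \<le> t \<and> r u = \<epsilon>" if "a \<le> t" "r t \<le> \<epsilon>" for t
    using IVT2'[of r t \<epsilon> a] that ra \<epsilon> r_cont by auto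
  have "closed S" unfolding S_def by (intro continuous_closed_preimage_constant r_cont) auto
  moreover have "bounded S" unfolding S_def by (rule bounded_subset[of "{a..b}"]) auto
  moreover have "S \<noteq> {}" using hit[of b] assms(1) rb by (auto simp: S_def)
  ultimately obtain t where t: "t \<in> S" "\<And>u. u \<in> S \<Longrightarrow> t \<le> u"
    using compact_attains_inf[of S] compact_eq_bounded_closed by blast
  have "r u \<ge> \<epsilon>" if au: "a \<le> u" and ut: "u \<le> t" for u
  proof (rule ccontr)
    assume u: "\<not> r u \<ge> \<epsilon>"
    then have "r u \<le> \<epsilon>" by simp
    then obtain v where v: "a \<le> v" "v \<le> u" "r v = \<epsilon>" using hit[OF au] by blast
    then have "v \<in> S" using t(1) ut by (simp add: S_def)
    then have "t \<le> v" by (rule t(2))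
    then have "v = u" using ut v(2) by simp
    then show False using u v(3) by simp
  qed
  then have "r u > 0" if "a \<le> u" "u \<le> t" for u using that \<epsilon> by (meson less_le_trans)
  then have "r t \<ge> 2 * \<epsilon>" using t(1) by (intro *) (auto simp: S_def)
  then show False using t(1) \<epsilon> by (simp add: S_def)
qed

end

text \<open>All constants are fixed before \<open>d\<close> and the orbit. A pass at time
  \<open>t\<close> closer than \<open>\<delta>\<close> and \<open>\<epsilon>\<close> leads into a
  cone at time \<open>t + s\<close>, which is not left before \<open>t + pi\<close>; so
  \<open>r (t + pi) >= \<epsilon>\<close>, against periodicity.\<close>

lemma (in closed_pursuit) soft_orbit_uniform_distance:
  obtains \<epsilon> where "\<epsilon> > 0" "\<And>d Q t. \<lbrakk>d > 0; soft_orbit d Q\<rbrakk> \<Longrightarrow> \<epsilon> \<le> norm (view Q t)"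
proof -
  obtain g0 g1 where g: "0 < g0" "\<And>t. g0 \<le> g t" "\<And>t. g t \<le> g1" by (rule g_bounds) blast
  obtain M where M: "0 < M" "\<And>t. norm (G t) \<le> M" by (rule G_bound) blast
  \<comment> \<open>\<open>Q\<close> and \<open>G\<close> both stay in the disc of radius
    \<open>M\<close>.\<close>
  define R where "R = 2 * M"
  define c where "c = (1 - n) * g0 / 2"
  have c: "c > 0" using n_less_1 g(1) by (simp add: c_def)
  define \<Lambda> where "\<Lambda> = 2 * g1 + R"
  have \<Lambda>: "\<Lambda> > 0" using g_pos[of 0] g(3)[of 0] M(1) by (simp add: \<Lambda>_def R_def)
  define s where "s = min 1 (c / 2 / \<Lambda>)"
  have s: "0 < s" "s \<le> 1" "(2 * g1 + R) * s \<le> c / 2"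
  proof -
    show "0 < s" "s \<le> 1" using c \<Lambda> by (auto simp: s_def)
    have "\<Lambda> * s \<le> \<Lambda> * (c / 2 / \<Lambda>)"
      using \<Lambda> by (intro mult_left_mono) (auto simp: s_def)
    also have "\<dots> = c / 2" using \<Lambda> by simp
    finally show "(2 * g1 + R) * s \<le> c / 2" by (simp add: \<Lambda>_def)
  qed
  define \<delta> where "\<delta> = min (c / 2) (c * s\<^sup>2 / 4)"
  have \<delta>: "\<delta> \<le> c / 2" "\<delta> \<le> c * s\<^sup>2 / 4" "\<delta> > 0" using c s by (auto simp: \<delta>_def)
  define k where "k = n * g1 / (c * s / 4)"
  define y0 where "y0 = exp (- k * s / 2) * (c * s / 4) * s / 2"
  have y0: "y0 > 0" using c s by (simp add: y0_def)
  \<comment> \<open>\<open>c * s^2 / 4\<close> is the deficit in \<open>pass_y_upper\<close>. As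
    \<open>x <= R\<close>, it is at least \<open>\<beta> * x\<close>, so the slope
    \<open>y / x\<close> is at most \<open>s - \<beta>\<close> after the pass.\<close>
  define \<beta> where "\<beta> = c * s\<^sup>2 / (4 * R)"
  have \<beta>: "\<beta> > 0" using c s M(1) by (simp add: \<beta>_def R_def)
  define C where "C = 1 + 2 / sin \<beta>"
  define l where "l = (1 - n) * ln y0 + n * ln (c * s / 4)"
  define \<epsilon> where "\<epsilon> = exp (l - C * pi) / 4"
  have "min \<delta> \<epsilon> \<le> norm (view Q t)" if "d > 0" "soft_orbit d Q" for d Q t
  proof (rule ccontr)
    have view_le: "norm (view Q t) \<le> R" for t
      using norm_triangle_ineq[of "Q t" "G t"] soft_orbit_bound[OF that M(2), of t] M(2)[of t]
      by (simp add: norm_view R_def)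
    interpret soft_pursuit g G n d Q g0 g1 R
      by unfold_locales (use that g view_le in auto)
    assume "\<not> min \<delta> \<epsilon> \<le> norm (view Q t)"
    then have close: "r t \<le> \<delta>" "r t < \<epsilon>" by (auto simp: r_def)
    note pass = c_def s \<delta>(1,2) close(1)
    define a where "a = t + s"
    have xa: "x a \<ge> c * s / 4" unfolding a_def using pass_x_late[OF pass, of "t + s"] s by simp
    have ya: "y a \<ge> y0" unfolding a_def y0_def k_def by (rule pass_y_lower[OF pass])
    have cs: "c * s / 4 > 0" using c s by simp
    have "y a \<le> s * x a - c * s\<^sup>2 / 4" unfolding a_def by (rule pass_y_upper[OF pass])
    also have "\<dots> \<le> s * x a - \<beta> * x a"
    proof -
      have "x a \<le> R" using r_bounds(2,3)[of a] by simp
      then have "\<beta> * x a \<le> \<beta> * R" using \<beta> by (intro mult_left_mono) auto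
      also have "\<dots> = c * s\<^sup>2 / 4" using M(1) by (simp add: \<beta>_def R_def)
      finally show ?thesis by simp
    qed
    finally have yx: "y a \<le> (s - \<beta>) * x a" by (simp add: left_diff_distrib)
    then have "0 \<le> (s - \<beta>) * x a" using ya y0 by simp
    then have \<beta>s: "\<beta> \<le> s" using xa cs by (simp add: zero_le_mult_iff)
    have pi: "pi > 3" using pi_gt3 .
    have cos0: "cos (s - \<beta>) \<ge> 0" using \<beta> \<beta>s s pi by (intro cos_ge_zero) auto
    have "y a * cos (s - \<beta>) \<le> (s - \<beta>) * x a * cos (s - \<beta>)"
      using yx cos0 by (intro mult_right_mono)
    also have "\<dots> = x a * ((s - \<beta>) * cos (s - \<beta>))" by simp
    also have "\<dots> \<le> x a * sin (s - \<beta>)"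
      using xa cs \<beta>s \<beta> s pi by (intro mult_left_mono mult_cos_le_sin) auto
    \<comment> \<open>The cone belongs to the frame frozen at time \<open>t + \<beta>\<close>. Its
      angle is \<open>s - \<beta>\<close> at time \<open>a\<close> and reaches just
      \<open>pi - \<beta>\<close> at time \<open>t + pi\<close>, as \<open>cone_slope\<close>
      demands.\<close>
    finally have start: "y a * cos (a - (t + \<beta>)) \<le> x a * sin (a - (t + \<beta>))"
      by (simp add: a_def)
    have sb: "sin \<beta> > 0" using \<beta> \<beta>s s pi by (intro sin_gt_zero) auto
    have "r (t + pi) \<ge> \<epsilon>"
      unfolding \<epsilon>_def
    proof (rule r_lower_bound[where a = a])
      show "a \<le> t + pi" "t + pi \<le> a + pi" using s pi by (auto simp: a_def)
      show "C \<ge> 0" using sb by (simp add: C_def)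
      show "r a > 0" using r_bounds(3)[of a] xa cs by simp
      have "(1 - n) * ln y0 \<le> (1 - n) * ln (y a)"
        using n_less_1 y0 ya by (intro mult_left_mono) auto
      moreover have "n * ln (c * s / 4) \<le> n * ln (r a + x a)"
      proof -
        have "c * s / 4 \<le> r a + x a" using xa r_bounds(1)[of a] by simp
        then show ?thesis using n_pos cs by (intro mult_left_mono) (auto simp: ln_mono)
      qed
      ultimately show "l \<le> L a" by (simp add: l_def L_def)
      fix u assume u: "a \<le> u" "u \<le> t + pi"
      have "y u * cos (u - (t + \<beta>)) \<le> x u * sin (u - (t + \<beta>))"
        using u start \<beta> \<beta>s by (intro cone_persists[of a u]) (auto simp: a_def)
      then show "- C * y u \<le> x u - n * r u"
        unfolding C_def using \<beta> \<beta>s s pi u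
        by (intro cone_slope[of \<beta> "u - (t + \<beta>)"]) (auto simp: a_def)
    qed
    then show False using close(2) r_periodic[of t] by simp
  qed
  moreover have "min \<delta> \<epsilon> > 0" using \<delta>(3) by (simp add: \<epsilon>_def)
  ultimately show ?thesis using that by blast
qed

subsection \<open>Asymptotic stability\<close>

text \<open>With \<open>c\<close> the cosine of the angle between \<open>v\<close> and
  \<open>w\<close>, both sides equal \<open>2 * (norm v + norm w) * (1 - c)\<close>. This makes the
  monotonicity of \<open>sgn\<close> quantitative.\<close>

lemma norm_sgn_diff_inner:
  fixes v w :: "'a::real_inner"
  assumes "v \<noteq> 0" "w \<noteq> 0"
  shows "2 * ((sgn v - sgn w) \<bullet> (v - w)) = (norm v + norm w) * (norm (sgn v - sgn w))\<^sup>2"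
proof -
  define c where "c = sgn v \<bullet> sgn w"
  have u: "sgn v \<bullet> sgn v = 1" "sgn w \<bullet> sgn w = 1" "sgn w \<bullet> sgn v = c"
    using assms by (auto simp: c_def dot_square_norm norm_sgn inner_commute)
  have "v - w = norm v *\<^sub>R sgn v - norm w *\<^sub>R sgn w" using assms by (simp add: sgn_div_norm)
  then have "(sgn v - sgn w) \<bullet> (v - w) = (norm v + norm w) * (1 - c)"
    by (simp only: inner_diff_left inner_diff_right inner_scaleR_right u c_def[symmetric])
      (simp add: algebra_simps)
  moreover have "(norm (sgn v - sgn w))\<^sup>2 = 2 * (1 - c)"
    by (simp only: power2_norm_eq_inner inner_diff_left inner_diff_right u c_def[symmetric]) simp
  ultimately show ?thesis by simp
qed

text \<open>The cross product of \<open>w\<close> with \<open>v - w\<close> equals that with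
  \<open>v\<close>, and the sine of the angle between \<open>v\<close> and \<open>w\<close> is at
  most the chord \<open>norm (sgn v - sgn w)\<close>.\<close>

lemma Im_cnj_mult_diff_le: "\<bar>Im (cnj w * (v - w))\<bar> \<le> norm w * norm v * norm (sgn v - sgn w)"
proof -
  have u: "norm z *\<^sub>R sgn z = z" for z :: complex by (cases "z = 0") (auto simp: sgn_div_norm)
  have "Im (cnj w * (v - w)) = Im (cnj w * v)" by (simp add: algebra_simps)
  also have "cnj w * v = cnj (norm w *\<^sub>R sgn w) * (norm v *\<^sub>R sgn v)" by (simp only: u)
  also have "Im \<dots> = norm w * norm v * Im (cnj (sgn w) * sgn v)" by (simp add: algebra_simps)
  also have "Im (cnj (sgn w) * sgn v) = Im (cnj (sgn w) * (sgn v - sgn w))" by (simp add: algebra_simps)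
  finally have "\<bar>Im (cnj w * (v - w))\<bar> = norm w * norm v * \<bar>Im (cnj (sgn w) * (sgn v - sgn w))\<bar>"
    by (simp add: abs_mult)
  also have "\<dots> \<le> norm w * norm v * (1 * norm (sgn v - sgn w))"
  proof (intro mult_left_mono)
    have "\<bar>Im (cnj (sgn w) * (sgn v - sgn w))\<bar> \<le> norm (sgn w) * norm (sgn v - sgn w)"
      by (metis abs_Im_le_cmod complex_mod_cnj norm_mult)
    also have "\<dots> \<le> 1 * norm (sgn v - sgn w)"
      by (intro mult_right_mono) (auto simp: norm_sgn)
    finally show "\<bar>Im (cnj (sgn w) * (sgn v - sgn w))\<bar> \<le> 1 * norm (sgn v - sgn w)" .
  qed auto
  finally show ?thesis by simp
qed

text \<open>Two exact solutions in the non-rotating frame: an arbitrary one, \<open>w1\<close>, from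
  time \<open>a\<close> on, and \<open>w2\<close>, which stems from a periodic solution.\<close>

locale pursuit_pair = closed_pursuit +
  fixes w1 w2 :: "real \<Rightarrow> complex" and a :: real
  assumes w1_deriv: "\<And>t. a \<le> t \<Longrightarrow>
      (w1 has_vector_derivative g t *\<^sub>R cis (- t) - (n * g t) *\<^sub>R sgn (w1 t)) (at t)"
    and w1_nz: "\<And>t. a \<le> t \<Longrightarrow> w1 t \<noteq> 0"
    and w2_deriv: "\<And>t. (w2 has_vector_derivative g t *\<^sub>R cis (- t) - (n * g t) *\<^sub>R sgn (w2 t)) (at t)"
    and w2_nz: "\<And>t. w2 t \<noteq> 0"
    and w2_antiperiodic: "\<And>t. w2 (t + pi) = - w2 t"
begin

definition D where "D t = w1 t - w2 t"
definition E where "E t = D t \<bullet> D t"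
definition e where "e t = norm (sgn (w1 t) - sgn (w2 t))"
text \<open>The dissipation: \<open>- p\<close> will be the derivative of the squared distance
  \<open>E\<close>.\<close>

definition p where "p t = n * g t * (norm (w1 t) + norm (w2 t)) * (e t)\<^sup>2"

lemma w2_cont: "continuous_on S w2"
  using w2_deriv by (meson continuous_at_imp_continuous_on has_vector_derivative_continuous)

lemma w2_bounds:
  obtains m M where "0 < m" "\<And>t. m \<le> norm (w2 t)" "\<And>t. norm (w2 t) \<le> M"
proof -
  have c: "continuous_on UNIV (\<lambda>t. norm (w2 t))" "continuous_on UNIV (\<lambda>t. - norm (w2 t))"
    by (intro continuous_intros w2_cont)+
  have p: "norm (w2 (t + pi)) = norm (w2 t)" "- norm (w2 (t + pi)) = - norm (w2 t)" for t
    by (simp_all add: w2_antiperiodic)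
  obtain t0 where "\<And>t. norm (w2 t0) \<le> norm (w2 t)"
    using periodic_attains_inf[OF c(1) p(1) pi_gt_zero] by blast
  moreover obtain t1 where "\<And>t. - norm (w2 t1) \<le> - norm (w2 t)"
    using periodic_attains_inf[OF c(2) p(2) pi_gt_zero] by blast
  ultimately show ?thesis using that[of "norm (w2 t0)" "norm (w2 t1)"] w2_nz by simp
qed

lemma w2_periodic: "w2 (t + 2 * pi * real k) = w2 t"
proof (induction k)
  case (Suc k)
  have "w2 (t + 2 * pi * real k + pi + pi) = w2 (t + 2 * pi * real k)"
    by (simp only: w2_antiperiodic minus_minus)
  moreover have "t + 2 * pi * real (Suc k) = t + 2 * pi * real k + pi + pi" by (simp add: algebra_simps)
  ultimately show ?case using Suc by (simp only:)
qed simp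

lemma D_deriv:
  assumes "a \<le> t"
  shows "(D has_vector_derivative - ((n * g t) *\<^sub>R (sgn (w1 t) - sgn (w2 t)))) (at t)"
proof -
  have "(D has_vector_derivative (g t *\<^sub>R cis (- t) - (n * g t) *\<^sub>R sgn (w1 t))
      - (g t *\<^sub>R cis (- t) - (n * g t) *\<^sub>R sgn (w2 t))) (at t)"
    unfolding D_def by (intro has_vector_derivative_diff w1_deriv w2_deriv assms)
  then show ?thesis by (simp add: scaleR_diff_right)
qed

lemma p_nonneg: "0 \<le> p t"
  unfolding p_def using n_pos g_pos[of t] by (intro mult_nonneg_nonneg add_nonneg_nonneg) auto

lemma E_deriv:
  assumes "a \<le> t"
  shows "(E has_real_derivative - p t) (at t)"
proof -
  have "(E has_real_derivative 2 * (D t \<bullet> - ((n * g t) *\<^sub>R (sgn (w1 t) - sgn (w2 t))))) (at t)"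
    unfolding E_def by (rule has_real_derivative_inner_self[OF D_deriv[OF assms]])
  moreover have "2 * (D t \<bullet> - ((n * g t) *\<^sub>R (sgn (w1 t) - sgn (w2 t))))
      = - (n * g t) * (2 * ((sgn (w1 t) - sgn (w2 t)) \<bullet> (w1 t - w2 t)))"
    unfolding D_def by (simp add: inner_commute)
  moreover have "\<dots> = - p t"
    unfolding p_def e_def norm_sgn_diff_inner[OF w1_nz[OF assms] w2_nz] by simp
  ultimately show ?thesis by (simp only:)
qed

lemma E_decreasing:
  assumes "a \<le> s" "s \<le> t"
  shows "E t \<le> E s"
proof -
  have "- E s \<le> - E t"
    by (rule nondecreasing_of_deriv[OF assms(2), where f = "\<lambda>t. - E t" and f' = p])
      (use assms E_deriv DERIV_minus[OF E_deriv] p_nonneg in auto)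
  then show ?thesis by simp
qed

lemma E_cont: "a \<le> s \<Longrightarrow> continuous_on {s..t} E"
  by (intro continuous_at_imp_continuous_on ballI DERIV_isCont[OF E_deriv]) auto

lemma D_cont: "a \<le> s \<Longrightarrow> continuous_on {s..t} D"
  by (intro continuous_at_imp_continuous_on ballI has_vector_derivative_continuous[OF D_deriv]) auto

text \<open>The speed of \<open>D\<close> is \<open>n * g * e\<close>, whereas the loss of
  \<open>E\<close> controls the square of \<open>e\<close>; the inequality
  \<open>e <= \<eta> + e^2 / \<eta>\<close> links the two. It follows that \<open>D\<close> is
  almost constant on late windows of bounded length.\<close>

lemma D_variation:
  obtains A B where "A > 0" "B > 0"
    "\<And>s t \<eta>. \<lbrakk>a \<le> s; s \<le> t; 0 < \<eta>\<rbrakk> \<Longrightarrow> norm (D t - D s) \<le> A * \<eta> * (t - s) + B / \<eta> * (E s - E t)"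
proof -
  obtain g0 g1 where g: "0 < g0" "\<And>t. g0 \<le> g t" "\<And>t. g t \<le> g1" by (rule g_bounds) blast
  obtain m M where m: "0 < m" "\<And>t. m \<le> norm (w2 t)" by (rule w2_bounds) blast
  have g1: "g1 > 0" using g_pos[of 0] g(3)[of 0] by simp
  define A where "A = n * g1"
  define B where "B = g1 / (g0 * m)"
  have "norm (D t - D s) \<le> A * \<eta> * (t - s) + B / \<eta> * (E s - E t)"
    if st: "a \<le> s" "s < t" and \<eta>: "0 < \<eta>" for s t \<eta>
  proof -
    define \<phi> where "\<phi> = (\<lambda>u. A * \<eta> * u - B / \<eta> * E u)"
    have "norm (D t - D s) \<le> \<phi> t - \<phi> s"
    proof (rule differentiable_bound_general[OF st(2) D_cont[OF st(1)]])
      show "continuous_on {s..t} \<phi>" unfolding \<phi>_def by (intro continuous_intros E_cont st)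
      fix u assume u: "s < u" "u < t"
      then have au: "a \<le> u" using st by simp
      show "(D has_vector_derivative - ((n * g u) *\<^sub>R (sgn (w1 u) - sgn (w2 u)))) (at u)"
        by (rule D_deriv[OF au])
      have "(\<phi> has_real_derivative A * \<eta> + B / \<eta> * p u) (at u)"
        unfolding \<phi>_def using \<eta> by (auto intro!: derivative_eq_intros E_deriv[OF au])
      then show "(\<phi> has_vector_derivative A * \<eta> + B / \<eta> * p u) (at u)"
        by (simp add: has_real_derivative_iff_has_vector_derivative)
      have "e u \<le> \<eta> + (e u)\<^sup>2 / \<eta>"
      proof (cases "e u \<le> \<eta>")
        case False
        then have "e u * \<eta> \<le> (e u)\<^sup>2" using \<eta> by (simp add: power2_eq_square)
        then have "e u \<le> (e u)\<^sup>2 / \<eta>" using \<eta> by (simp add: pos_le_divide_eq)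
        then show ?thesis using \<eta> by simp
      qed (use \<eta> in \<open>simp add: add_increasing2\<close>)
      then have "n * g u * e u \<le> n * g1 * (\<eta> + (e u)\<^sup>2 / \<eta>)"
        using n_pos g_pos[of u] g(3)[of u] by (intro mult_mono) (auto simp: e_def)
      also have "\<dots> = A * \<eta> + B / \<eta> * (n * g0 * m * (e u)\<^sup>2)"
        using g m \<eta> by (simp add: A_def B_def field_simps)
      also have "\<dots> \<le> A * \<eta> + B / \<eta> * p u"
      proof (intro add_left_mono mult_left_mono)
        show "n * g0 * m * (e u)\<^sup>2 \<le> p u"
          unfolding p_def using n_pos g(1) g(2)[of u] m(1) m(2)[of u]
          by (intro mult_right_mono mult_mono) (auto intro: add_increasing)
      qed (use g1 g m \<eta> in \<open>auto simp: B_def\<close>)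
      finally have "n * g u * e u \<le> A * \<eta> + B / \<eta> * p u" .
      then show "norm (- ((n * g u) *\<^sub>R (sgn (w1 u) - sgn (w2 u)))) \<le> A * \<eta> + B / \<eta> * p u"
        using n_pos g_pos[of u] by (simp add: e_def abs_mult)
    qed
    then show ?thesis by (simp add: \<phi>_def algebra_simps)
  qed
  then have "norm (D t - D s) \<le> A * \<eta> * (t - s) + B / \<eta> * (E s - E t)"
    if "a \<le> s" "s \<le> t" "0 < \<eta>" for s t \<eta>
    using that by (cases "s = t") auto
  moreover have "A > 0" "B > 0" using n_pos g1 g(1) m(1) by (auto simp: A_def B_def)
  ultimately show ?thesis using that by blast
qed

text \<open>By \<open>Im_cnj_mult_diff_le\<close> the cross product is at most a bounded factor
  times \<open>e\<close>; here \<open>w1\<close> is bounded because \<open>E\<close> decreases.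
  Misalignment of \<open>D\<close> and \<open>w2\<close> thus forces dissipation.\<close>

lemma cross_bound:
  obtains K where "K > 0" "\<And>t. a \<le> t \<Longrightarrow> (Im (cnj (w2 t) * D t))\<^sup>2 \<le> K * p t"
proof -
  obtain g0 g1 where g: "0 < g0" "\<And>t. g0 \<le> g t" "\<And>t. g t \<le> g1" by (rule g_bounds) blast
  obtain m M where m: "0 < m" "\<And>t. m \<le> norm (w2 t)" "\<And>t. norm (w2 t) \<le> M" by (rule w2_bounds) blast
  have M: "M > 0" using m(1) m(2)[of 0] m(3)[of 0] by linarith
  define R where "R = M + norm (D a)"
  have R: "R > 0" using M by (simp add: R_def add_pos_nonneg)
  have "(Im (cnj (w2 t) * D t))\<^sup>2 \<le> (M * R)\<^sup>2 / (n * g0 * m) * p t" if "a \<le> t" for t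
  proof -
    have "norm (D t) \<le> norm (D a)" using E_decreasing[OF order_refl that] by (simp add: E_def dot_square_norm)
    moreover have "norm (w1 t) \<le> norm (w2 t) + norm (D t)"
      unfolding D_def by (metis add.commute diff_add_cancel norm_triangle_ineq)
    ultimately have w1: "norm (w1 t) \<le> R" using m(3)[of t] by (simp add: R_def)
    have "\<bar>Im (cnj (w2 t) * D t)\<bar> \<le> norm (w2 t) * norm (w1 t) * e t"
      unfolding D_def e_def by (rule Im_cnj_mult_diff_le)
    also have "\<dots> \<le> M * R * e t"
      using w1 m(3)[of t] M R by (intro mult_mono mult_right_mono) (auto simp: e_def)
    finally have "\<bar>Im (cnj (w2 t) * D t)\<bar>\<^sup>2 \<le> (M * R * e t)\<^sup>2" by (intro power_mono) auto
    also have "\<dots> = (M * R)\<^sup>2 / (n * g0 * m) * (n * g0 * m * (e t)\<^sup>2)"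
      using n_pos g(1) m(1) by (simp add: power_mult_distrib)
    also have "\<dots> \<le> (M * R)\<^sup>2 / (n * g0 * m) * p t"
    proof (intro mult_left_mono)
      show "n * g0 * m * (e t)\<^sup>2 \<le> p t"
        unfolding p_def using n_pos g(1) g(2)[of t] m(1) m(2)[of t]
        by (intro mult_right_mono mult_mono) (auto intro: add_increasing)
    qed (use n_pos g(1) m(1) in auto)
    finally show ?thesis by simp
  qed
  moreover have "(M * R)\<^sup>2 / (n * g0 * m) > 0" using M R n_pos g(1) m(1) by simp
  ultimately show ?thesis using that by blast
qed

text \<open>In the derivative of the hypothesis the \<open>sgn\<close> term drops out, being
  parallel to \<open>w2\<close>, and \<open>Im (cis t * v) = 0\<close> is left;
  \<open>t = pi / 2\<close> and \<open>t = pi\<close> give the real and the imaginary part of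
  \<open>v\<close>.\<close>

lemma perp_all_zero:
  assumes "\<And>t. t > 0 \<Longrightarrow> Im (cnj (w2 t) * v) = 0"
  shows "v = 0"
proof -
  have "Im (cis t * v) = 0" if "t > 0" for t
  proof -
    have "((\<lambda>t. cnj (w2 t) * v) has_vector_derivative
        cnj (g t *\<^sub>R cis (- t) - (n * g t) *\<^sub>R sgn (w2 t)) * v) (at t)"
      using bounded_linear.has_vector_derivative[OF bounded_linear_cnj w2_deriv[of t]]
      by (rule has_vector_derivative_mult_left)
    from bounded_linear.has_vector_derivative[OF bounded_linear_Im this]
    have "((\<lambda>t. Im (cnj (w2 t) * v)) has_real_derivative
        Im (cnj (g t *\<^sub>R cis (- t) - (n * g t) *\<^sub>R sgn (w2 t)) * v)) (at t)"
      by (simp only: has_real_derivative_iff_has_vector_derivative)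
    moreover have "((\<lambda>t. Im (cnj (w2 t) * v)) has_real_derivative 0) (at t)"
      by (rule has_field_derivative_transform_within_open[where S = "{0<..}" and f = "\<lambda>_. 0"])
        (use that assms in auto)
    ultimately have "Im (cnj (g t *\<^sub>R cis (- t) - (n * g t) *\<^sub>R sgn (w2 t)) * v) = 0"
      by (rule DERIV_unique)
    moreover have "cnj (g t *\<^sub>R cis (- t) - (n * g t) *\<^sub>R sgn (w2 t)) * v
        = g t *\<^sub>R (cis t * v) - (n * g t / norm (w2 t)) *\<^sub>R (cnj (w2 t) * v)"
      by (simp add: sgn_div_norm cis_cnj left_diff_distrib divide_inverse)
    ultimately have "g t * Im (cis t * v) = 0" using assms[OF that] by (simp only: minus_complex.sel scaleR_complex.sel)
    then show ?thesis using g_pos[of t] by (metis less_irrefl mult_eq_0_iff)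
  qed
  from this[of "pi / 2"] this[of pi] show ?thesis by (simp add: complex_eq_iff)
qed

text \<open>A compactness argument in the manner of LaSalle: \<open>E\<close> converges, so late
  windows lose little of it and \<open>D\<close> is nearly constant on them. If a limit vector
  \<open>v\<close> of \<open>D\<close> were not parallel to \<open>w2\<close>, late windows would
  lose at least a fixed amount.\<close>

lemma distance_tendsto_zero: "((\<lambda>t. norm (w1 t - w2 t)) \<longlongrightarrow> 0) at_top"
proof -
  \<comment> \<open>The sampling times \<open>T k\<close> are multiples of the period
    \<open>2 * pi\<close> of \<open>w2\<close>, so \<open>w2\<close> looks the same on every window;
    \<open>k0\<close> places them all after \<open>a\<close>.\<close>
  obtain k0 :: nat where k0: "a / (2 * pi) \<le> real k0" using real_arch_simple by blast
  define T where "T k = 2 * pi * real (k + k0)" for k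
  have aT: "a \<le> T k" for k
  proof -
    have "a \<le> 2 * pi * real k0" using k0 by (simp add: field_simps)
    also have "\<dots> \<le> T k" unfolding T_def by (intro mult_left_mono) auto
    finally show ?thesis .
  qed
  have E_nonneg: "0 \<le> E t" for t by (simp add: E_def)
  have "decseq (\<lambda>k. E (T k))"
    by (intro decseq_SucI E_decreasing aT) (simp add: T_def)
  then have conv: "convergent (\<lambda>k. E (T k))"
    by (metis E_nonneg convergent_def decseq_convergent)
  have drop: "((\<lambda>k. E (T k) - E (T k + \<tau>)) \<longlongrightarrow> 0) sequentially" if "0 \<le> \<tau>" for \<tau>
  proof -
    obtain j :: nat where j: "\<tau> / (2 * pi) \<le> real j" using real_arch_simple by blast
    have Tj: "T k + \<tau> \<le> T (k + j)" for k using j by (simp add: T_def field_simps)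
    obtain l where l: "(\<lambda>k. E (T k)) \<longlonglongrightarrow> l" using conv by (auto simp: convergent_def)
    have "(\<lambda>k. E (T k) - E (T (k + j))) \<longlonglongrightarrow> l - l"
      by (intro tendsto_diff l LIMSEQ_ignore_initial_segment[OF l])
    then have up: "(\<lambda>k. E (T k) - E (T (k + j))) \<longlonglongrightarrow> 0" by simp
    show ?thesis
    proof (rule tendsto_sandwich[OF _ _ tendsto_const up])
      show "\<forall>\<^sub>F k in sequentially. 0 \<le> E (T k) - E (T k + \<tau>)"
        using E_decreasing[OF aT] that by (auto intro!: always_eventually)
      show "\<forall>\<^sub>F k in sequentially. E (T k) - E (T k + \<tau>) \<le> E (T k) - E (T (k + j))"
      proof (intro always_eventually allI)
        fix k
        have "a \<le> T k + \<tau>" using aT[of k] that by simp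
        then show "E (T k) - E (T k + \<tau>) \<le> E (T k) - E (T (k + j))"
          using E_decreasing[OF _ Tj[of k]] by simp
      qed
    qed
  qed
  obtain A B where AB: "A > 0" "B > 0"
    "\<And>s t \<eta>. \<lbrakk>a \<le> s; s \<le> t; 0 < \<eta>\<rbrakk> \<Longrightarrow> norm (D t - D s) \<le> A * \<eta> * (t - s) + B / \<eta> * (E s - E t)"
    by (rule D_variation) blast
  have steady: "\<forall>\<^sub>F k in sequentially. \<forall>\<tau>\<in>{0..b}. norm (D (T k + \<tau>) - D (T k)) \<le> \<epsilon>"
    if b: "0 < b" and \<epsilon>: "0 < \<epsilon>" for b \<epsilon>
  proof -
    \<comment> \<open>Makes \<open>A * \<eta> * b\<close> equal to \<open>\<epsilon> / 2\<close>;
      the smallness required of the drop of \<open>E\<close> yields the other half.\<close>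
    define \<eta> where "\<eta> = \<epsilon> / (2 * A * b)"
    have \<eta>: "\<eta> > 0" using b \<epsilon> AB by (simp add: \<eta>_def)
    have "\<forall>\<^sub>F k in sequentially. E (T k) - E (T k + b) < \<epsilon> * \<eta> / (2 * B)"
      by (rule order_tendstoD(2)[OF drop]) (use b \<epsilon> \<eta> AB in auto)
    then show ?thesis
    proof (rule eventually_mono, intro ballI)
      fix k \<tau> assume k: "E (T k) - E (T k + b) < \<epsilon> * \<eta> / (2 * B)" and \<tau>: "\<tau> \<in> {0..b}"
      have "norm (D (T k + \<tau>) - D (T k)) \<le> A * \<eta> * \<tau> + B / \<eta> * (E (T k) - E (T k + \<tau>))"
        using AB(3)[OF aT[of k] _ \<eta>, of "T k + \<tau>"] \<tau> by simp
      also have "\<dots> \<le> A * \<eta> * b + B / \<eta> * (\<epsilon> * \<eta> / (2 * B))"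
      proof (intro add_mono mult_left_mono)
        have "a \<le> T k + \<tau>" using aT[of k] \<tau> by simp
        then have "E (T k + b) \<le> E (T k + \<tau>)" using \<tau> by (intro E_decreasing) auto
        then show "E (T k) - E (T k + \<tau>) \<le> \<epsilon> * \<eta> / (2 * B)" using k by simp
      qed (use \<tau> AB \<eta> in auto)
      also have "\<dots> = \<epsilon>" using AB \<eta> b by (simp add: \<eta>_def)
      finally show "norm (D (T k + \<tau>) - D (T k)) \<le> \<epsilon>" .
    qed
  qed
  have "\<forall>k. D (T k) \<in> cball 0 (norm (D a))"
    using E_decreasing[OF order_refl aT] by (simp add: E_def dot_square_norm)
  then obtain v \<sigma> where \<sigma>: "strict_mono \<sigma>" and v: "(\<lambda>k. D (T (\<sigma> k))) \<longlonglongrightarrow> v"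
    using seq_compactE[OF compact_imp_seq_compact[OF compact_cball[of 0 "norm (D a)"]], of "\<lambda>k. D (T k)"]
    unfolding o_def by blast
  have "Im (cnj (w2 t) * v) = 0" if t: "t > 0" for t
  proof (rule ccontr)
    define f where "f \<tau> = \<bar>Im (cnj (w2 \<tau>) * v)\<bar>" for \<tau>
    assume "Im (cnj (w2 t) * v) \<noteq> 0"
    then have ft: "f t > 0" by (simp add: f_def)
    define c where "c = f t / 2"
    have c: "c > 0" using ft by (simp add: c_def)
    have "continuous_on UNIV f" unfolding f_def by (intro continuous_intros w2_cont)
    then have "f \<midarrow>t\<rightarrow> f t" by (simp add: continuous_on_eq_continuous_at isCont_def)
    then have "\<forall>\<^sub>F u in at t. f u > c" using ft by (intro order_tendstoD) (auto simp: c_def)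
    then obtain h where h: "h > 0" "\<And>u. \<lbrakk>u \<noteq> t; dist u t < h\<rbrakk> \<Longrightarrow> f u > c"
      by (auto simp: eventually_at)
    define b where "b = t + h / 2"
    have fc: "f u \<ge> c" if "u \<in> {t..b}" for u
      using h(1) h(2)[of u] that ft by (cases "u = t") (auto simp: b_def dist_real_def c_def)
    have tb: "0 < b" "t < b" using t h by (auto simp: b_def)
    obtain K where K: "K > 0" "\<And>t. a \<le> t \<Longrightarrow> (Im (cnj (w2 t) * D t))\<^sup>2 \<le> K * p t"
      by (rule cross_bound) blast
    obtain m M where m: "0 < m" "\<And>t. m \<le> norm (w2 t)" "\<And>t. norm (w2 t) \<le> M" by (rule w2_bounds) blast
    have M: "M > 0" using m(1) m(2)[of 0] m(3)[of 0] by linarith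
    \<comment> \<open>The two errors in replacing \<open>v\<close> by \<open>D z\<close>, times the
      bound \<open>M\<close> on \<open>w2\<close>, add up to \<open>c / 2\<close>, half of the lower
      bound for the cross product with \<open>v\<close>.\<close>
    define \<epsilon> where "\<epsilon> = c / (4 * M)"
    have \<epsilon>: "\<epsilon> > 0" using c M by (simp add: \<epsilon>_def)
    define q where "q = (c / 2)\<^sup>2 / K * (b - t)"
    have q: "q > 0" using c K(1) tb by (simp add: q_def)
    have "\<forall>\<^sub>F k in sequentially. \<forall>\<tau>\<in>{0..b}. norm (D (T (\<sigma> k) + \<tau>) - D (T (\<sigma> k))) \<le> \<epsilon>"
      using eventually_subseq[OF \<sigma> steady[OF tb(1) \<epsilon>]] .
    moreover have "\<forall>\<^sub>F k in sequentially. dist (D (T (\<sigma> k))) v < \<epsilon>"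
      using tendstoD[OF v \<epsilon>] .
    moreover have "\<forall>\<^sub>F k in sequentially. E (T (\<sigma> k)) - E (T (\<sigma> k) + b) < q"
      by (rule eventually_subseq[OF \<sigma> order_tendstoD(2)[OF drop q]]) (use tb in auto)
    ultimately have "\<forall>\<^sub>F k in sequentially. False"
    proof eventually_elim
      case (elim k)
      define S where "S = T (\<sigma> k)"
      have aS: "a \<le> S" unfolding S_def by (rule aT)
      have "S + t < S + b" using tb by simp
      moreover have "(E has_real_derivative - p u) (at u)" if "S + t \<le> u" for u
        using that aS t by (intro E_deriv) auto
      \<comment> \<open>The mean value theorem reduces the loss of \<open>E\<close> between
        \<open>S + t\<close> and \<open>S + b\<close> to the dissipation at a single time
        \<open>z\<close>, where it is at least \<open>(c / 2)^2 / K\<close>.\<close>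
      ultimately obtain z where z: "S + t < z" "z < S + b" "E (S + b) - E (S + t) = (b - t) * - p z"
        using MVT2[of "S + t" "S + b" E "\<lambda>u. - p u"] by auto
      define \<tau> where "\<tau> = z - S"
      have \<tau>: "\<tau> \<in> {t..b}" "\<tau> \<in> {0..b}" using z t by (auto simp: \<tau>_def)
      have w2z: "w2 z = w2 \<tau>" using w2_periodic[of \<tau> "\<sigma> k + k0"] by (simp add: \<tau>_def S_def T_def)
      have "D z - v = (D (S + \<tau>) - D S) + (D S - v)" by (simp add: \<tau>_def)
      also have "norm \<dots> \<le> \<epsilon> + \<epsilon>"
        using elim(1,2) \<tau>(2) by (intro order_trans[OF norm_triangle_ineq] add_mono) (auto simp: S_def dist_norm)
      finally have Dz: "norm (D z - v) \<le> c / (2 * M)" by (simp add: \<epsilon>_def)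
      have "\<bar>Im (cnj (w2 \<tau>) * (D z - v))\<bar> \<le> norm (w2 \<tau>) * norm (D z - v)"
        by (metis abs_Im_le_cmod complex_mod_cnj norm_mult)
      also have "\<dots> \<le> M * (c / (2 * M))" using m(3)[of \<tau>] Dz M by (intro mult_mono) auto
      also have "\<dots> = c / 2" using M by simp
      finally have "\<bar>Im (cnj (w2 \<tau>) * (D z - v))\<bar> \<le> c / 2" .
      moreover have "Im (cnj (w2 \<tau>) * (D z - v)) = Im (cnj (w2 \<tau>) * D z) - Im (cnj (w2 \<tau>) * v)"
        by (simp only: right_diff_distrib minus_complex.sel)
      moreover have "c \<le> \<bar>Im (cnj (w2 \<tau>) * v)\<bar>" using fc[OF \<tau>(1)] by (simp only: f_def)
      ultimately have "\<bar>Im (cnj (w2 z) * D z)\<bar> \<ge> c / 2" unfolding w2z by linarith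
      then have "(c / 2)\<^sup>2 \<le> \<bar>Im (cnj (w2 z) * D z)\<bar>\<^sup>2" using c by (intro power_mono) auto
      also have "\<dots> \<le> K * p z" using K(2)[of z] z aS t by simp
      finally have "(c / 2)\<^sup>2 / K \<le> p z" using K(1) by (simp add: field_simps)
      then have "q \<le> (b - t) * p z" 
        unfolding q_def using tb by (subst mult.commute, intro mult_left_mono) auto
      also have "\<dots> = E (S + t) - E (S + b)" using z(3) by simp
      also have "\<dots> \<le> E S - E (S + b)" using E_decreasing[of S "S + t"] aS t by simp
      finally show False using elim(3) by (simp add: S_def)
    qed
    then show False by simp
  qed
  then have "v = 0" by (rule perp_all_zero)
  then have v0: "(\<lambda>k. norm (D (T (\<sigma> k)))) \<longlonglongrightarrow> 0" using tendsto_norm[OF v] by simp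
  have "((\<lambda>t. norm (D t)) \<longlongrightarrow> 0) at_top"
  proof (rule tendstoI)
    fix \<epsilon> :: real assume "\<epsilon> > 0"
    then obtain k where k: "norm (D (T (\<sigma> k))) < \<epsilon>"
      using order_tendstoD(2)[OF v0] by (auto simp: eventually_sequentially)
    \<comment> \<open>Smallness at one sampling time persists because \<open>E\<close>
      decreases.\<close>
    have "norm (D t) < \<epsilon>" if "t \<ge> T (\<sigma> k)" for t
      using E_decreasing[OF aT that] k by (simp add: E_def dot_square_norm)
    then show "\<forall>\<^sub>F t in at_top. dist (norm (D t)) 0 < \<epsilon>"
      by (auto simp: eventually_at_top_linorder)
  qed
  then show ?thesis by (simp add: D_def)
qed

end

subsection \<open>The ellipse\<close>

text \<open>The square of the distance from the centre to the tangent line whose argument is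
  \<open>t\<close>.\<close>

definition ellipse_S :: "real \<Rightarrow> real \<Rightarrow> real \<Rightarrow> real" where
  "ellipse_S a b t = a\<^sup>2 * (sin t)\<^sup>2 + b\<^sup>2 * (cos t)\<^sup>2"

text \<open>The complex conjugate of the point of the ellipse whose tangent has argument \<open>t\<close>.\<close>
definition ellipse_pos :: "real \<Rightarrow> real \<Rightarrow> real \<Rightarrow> complex" where
  "ellipse_pos a b t = Complex (a\<^sup>2 * sin t / sqrt (ellipse_S a b t)) (b\<^sup>2 * cos t / sqrt (ellipse_S a b t))"

lemma ellipse_S_pos:
  assumes "a > 0" "b > 0"
  shows "ellipse_S a b t > 0"
proof (cases "sin t = 0")
  case True
  then have "(cos t)\<^sup>2 = 1" using sin_cos_squared_add[of t] by simp
  then show ?thesis using assms True by (simp add: ellipse_S_def)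
qed (use assms in \<open>auto simp: ellipse_S_def intro!: add_pos_nonneg\<close>)

lemma ellipse_f_eq:
  assumes "a > 0" "b > 0"
  shows "ellipse_f a b t = ellipse_S a b t * sqrt (ellipse_S a b t) / (a\<^sup>2 * b\<^sup>2)"
proof -
  have "ellipse_S a b t powr (1 + 1 / 2) = ellipse_S a b t * sqrt (ellipse_S a b t)"
    unfolding powr_add using ellipse_S_pos[OF assms, of t] by (simp add: powr_half_sqrt)
  then show ?thesis by (simp add: ellipse_f_def ellipse_S_def)
qed

lemma ellipse_f_pos: "a > 0 \<Longrightarrow> b > 0 \<Longrightarrow> ellipse_f a b t > 0"
  using ellipse_S_pos[of a b t] by (simp add: ellipse_f_eq)

lemma ellipse_pos_deriv:
  assumes "a > 0" "b > 0"
  shows "(ellipse_pos a b has_vector_derivative (1 / ellipse_f a b t) *\<^sub>R cis (- t)) (at t)"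
proof -
  define S where "S = ellipse_S a b"
  define H where "H = (a\<^sup>2 - b\<^sup>2) * sin t * cos t"
  have S: "S t > 0" unfolding S_def by (rule ellipse_S_pos[OF assms])
  have dS: "(S has_real_derivative 2 * H) (at t)"
    unfolding S_def ellipse_S_def[abs_def] H_def
    by (auto intro!: derivative_eq_intros simp: algebra_simps)
  have dq: "((\<lambda>t. sqrt (S t)) has_real_derivative inverse (sqrt (S t)) / 2 * (2 * H)) (at t)"
    by (rule DERIV_chain2[OF DERIV_real_sqrt[OF S] dS])
  define q where "q = sqrt (S t)"
  have q: "q > 0" "q * q = S t" using S by (auto simp: q_def)
  have quot: "((\<lambda>t. h t / sqrt (S t)) has_real_derivative (h' * S t - h t * H) / (S t * q)) (at t)"
    if "(h has_real_derivative h') (at t)" for h h'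
  proof -
    have "((\<lambda>t. h t / sqrt (S t)) has_real_derivative
        (h' * sqrt (S t) - h t * (inverse (sqrt (S t)) / 2 * (2 * H))) / (sqrt (S t) * sqrt (S t))) (at t)"
      using S by (intro DERIV_divide that dq) auto
    moreover have "(h' * q - h t * (inverse q / 2 * (2 * H))) / (q * q) = (h' * (q * q) - h t * H) / (q * q * q)"
      using q(1) by (simp add: field_simps)
    ultimately show ?thesis by (simp only: q_def[symmetric] q(2))
  qed
  \<comment> \<open>These identities collapse the numerators of the quotient rule, with
    \<open>s\<close> and \<open>c\<close> standing for sine and cosine.\<close>
  have id1: "a\<^sup>2 * c * (a\<^sup>2 * s\<^sup>2 + b\<^sup>2 * c\<^sup>2) - a\<^sup>2 * s * ((a\<^sup>2 - b\<^sup>2) * s * c) = a\<^sup>2 * b\<^sup>2 * c * (s\<^sup>2 + c\<^sup>2)"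
    and id2: "- (b\<^sup>2 * s) * (a\<^sup>2 * s\<^sup>2 + b\<^sup>2 * c\<^sup>2) - b\<^sup>2 * c * ((a\<^sup>2 - b\<^sup>2) * s * c) = - (a\<^sup>2 * b\<^sup>2 * s) * (s\<^sup>2 + c\<^sup>2)"
    for s c :: real
    by (simp_all add: algebra_simps power2_eq_square)
  have "((\<lambda>t. a\<^sup>2 * sin t / sqrt (S t)) has_real_derivative
      (a\<^sup>2 * cos t * S t - a\<^sup>2 * sin t * H) / (S t * q)) (at t)"
    by (rule quot) (auto intro!: derivative_eq_intros)
  moreover have "a\<^sup>2 * cos t * S t - a\<^sup>2 * sin t * H = a\<^sup>2 * b\<^sup>2 * cos t * ((sin t)\<^sup>2 + (cos t)\<^sup>2)"
    unfolding S_def ellipse_S_def H_def by (rule id1)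
  ultimately have re: "((\<lambda>t. a\<^sup>2 * sin t / sqrt (S t)) has_real_derivative a\<^sup>2 * b\<^sup>2 * cos t / (S t * q)) (at t)"
    by (simp only: sin_cos_squared_add mult_1_right)
  have "((\<lambda>t. b\<^sup>2 * cos t / sqrt (S t)) has_real_derivative
      (- (b\<^sup>2 * sin t) * S t - b\<^sup>2 * cos t * H) / (S t * q)) (at t)"
    by (rule quot) (auto intro!: derivative_eq_intros)
  moreover have "- (b\<^sup>2 * sin t) * S t - b\<^sup>2 * cos t * H = - (a\<^sup>2 * b\<^sup>2 * sin t) * ((sin t)\<^sup>2 + (cos t)\<^sup>2)"
    unfolding S_def ellipse_S_def H_def by (rule id2)
  ultimately have im: "((\<lambda>t. b\<^sup>2 * cos t / sqrt (S t)) has_real_derivative - (a\<^sup>2 * b\<^sup>2 * sin t) / (S t * q)) (at t)"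
    by (simp only: sin_cos_squared_add mult_1_right)
  have "(1 / ellipse_f a b t) *\<^sub>R cis (- t)
      = Complex (a\<^sup>2 * b\<^sup>2 * cos t / (S t * q)) (- (a\<^sup>2 * b\<^sup>2 * sin t) / (S t * q))"
    by (simp add: ellipse_f_eq[OF assms] S_def q_def complex_eq_iff)
  then show ?thesis
    using re im unfolding has_vector_derivative_complex_iff ellipse_pos_def S_def[symmetric]
    by simp
qed

text \<open>Cauchy--Schwarz in the form of Lagrange's identity: \<open>S s * S t - c^2\<close> is a
  square. The right-hand side is the support function \<open>sqrt (S s)\<close>.\<close>

lemma ellipse_pos_support:
  assumes "a > 0" "b > 0"
  shows "Im (cis s * ellipse_pos a b t) \<le> Im (cis s * ellipse_pos a b s)"
proof -
  define S where "S = ellipse_S a b"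
  have S: "S t > 0" "S s > 0" unfolding S_def by (simp_all add: ellipse_S_pos assms)
  define c where "c = a\<^sup>2 * sin s * sin t + b\<^sup>2 * cos s * cos t"
  have "S s * S t - c\<^sup>2 = (a * b * (sin s * cos t - cos s * sin t))\<^sup>2"
    by (simp add: S_def ellipse_S_def c_def power2_eq_square algebra_simps)
  then have "c\<^sup>2 \<le> S s * S t" by (metis diff_ge_0_iff_ge zero_le_power2)
  then have "c \<le> sqrt (S s) * sqrt (S t)" by (metis real_le_rsqrt real_sqrt_mult)
  then have "c / sqrt (S t) \<le> sqrt (S s)" using S by (simp add: pos_divide_le_eq)
  moreover have "Im (cis s * ellipse_pos a b t) = c / sqrt (S t)"
    by (simp add: ellipse_pos_def c_def S_def add_divide_distrib mult_ac)
  moreover have "Im (cis s * ellipse_pos a b s) = S s / sqrt (S s)"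
    by (simp add: ellipse_pos_def S_def[symmetric] add_divide_distrib power2_eq_square mult_ac)
      (simp add: S_def ellipse_S_def add_divide_distrib power2_eq_square mult_ac)
  ultimately show ?thesis using S by (simp add: real_div_sqrt)
qed

lemma closed_pursuit_ellipse:
  assumes "a > 0" "b > 0" "0 < n" "n < 1"
  shows "closed_pursuit (\<lambda>t. 1 / ellipse_f a b t) (ellipse_pos a b) n"
proof
  show "continuous_on UNIV (\<lambda>t. 1 / ellipse_f a b t)"
    unfolding ellipse_f_eq[OF assms(1,2)] ellipse_S_def
    using ellipse_S_pos[OF assms(1,2)] assms
    by (intro continuous_intros) (auto simp: ellipse_S_def less_imp_neq[symmetric])
  show "1 / ellipse_f a b (t + pi) = 1 / ellipse_f a b t" for t by (simp add: ellipse_f_def)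
  show "ellipse_pos a b (t + pi) = - ellipse_pos a b t" for t
    by (simp add: ellipse_pos_def ellipse_S_def complex_eq_iff)
qed (use assms ellipse_f_pos ellipse_pos_deriv ellipse_pos_support in auto)

section \<open>Translation between the real system and complex curves\<close>

lemma pursuit_curve_eq: "pursuit_curve \<mu> \<zeta> t = exp (\<mu> t) *\<^sub>R cis (\<zeta> t)"
  by (simp add: pursuit_curve_def exp_add cis_conv_exp scaleR_conv_of_real exp_of_real)

text \<open>The curve in the non-rotating frame: the conjugate of the vector from the pursuer to the evader.\<close>
lemma pursuit_solution_fixed_frame_deriv:
  assumes sol: "pursuit_solution a b n T \<mu> \<zeta>" and t: "t \<in> interior T"
  defines "w \<equiv> \<lambda>t. cis (- t) * pursuit_curve \<mu> \<zeta> t" and "g \<equiv> 1 / ellipse_f a b t"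
  shows "(w has_vector_derivative g *\<^sub>R cis (- t) - (n * g) *\<^sub>R sgn (w t)) (at t)"
proof -
  define \<mu>' where "\<mu>' = exp (- \<mu> t) * (cos (\<zeta> t) - n) / ellipse_f a b t"
  define \<zeta>' where "\<zeta>' = - (exp (- \<mu> t) * sin (\<zeta> t) / ellipse_f a b t) + 1"
  have "t \<in> T" "at t within T = at t" using t interior_subset by (auto intro: at_within_interior)
  then have d: "(\<mu> has_real_derivative \<mu>') (at t)" "(\<zeta> has_real_derivative \<zeta>') (at t)"
    using sol unfolding pursuit_solution_def \<mu>'_def \<zeta>'_def by force+
  \<comment> \<open>A logarithm of \<open>w\<close>: the factor \<open>cis (- t)\<close> lowers the
    angle by \<open>t\<close>, which cancels the summand 1 in the equation for
    \<open>\<zeta>\<close>.\<close>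
  define h where "h = (\<lambda>t. Complex (\<mu> t) (\<zeta> t - t))"
  have "(h has_vector_derivative Complex \<mu>' (\<zeta>' - 1)) (at t)"
    unfolding has_vector_derivative_complex_iff h_def using d by (auto intro!: derivative_eq_intros)
  then have "(exp \<circ> h has_vector_derivative Complex \<mu>' (\<zeta>' - 1) * exp (h t)) (at t)"
    by (rule field_vector_diff_chain_at) (rule DERIV_exp)
  moreover have "exp (h t) = w t" for t
    by (simp add: h_def w_def pursuit_curve_eq exp_eq_polar cis_mult scaleR_conv_of_real mult.left_commute add.commute)
  ultimately have "(w has_vector_derivative Complex \<mu>' (\<zeta>' - 1) * w t) (at t)"
    by (simp add: o_def)
  moreover have "Complex \<mu>' (\<zeta>' - 1) * w t = g *\<^sub>R cis (- t) - (n * g) *\<^sub>R sgn (w t)"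
  proof -
    have "Complex \<mu>' (\<zeta>' - 1) = (g * exp (- \<mu> t)) *\<^sub>R (cis (- \<zeta> t) - of_real n)"
      by (simp add: complex_eq_iff \<mu>'_def \<zeta>'_def g_def)
    moreover have w: "w t = exp (\<mu> t) *\<^sub>R (cis (- t) * cis (\<zeta> t))" by (simp add: w_def pursuit_curve_eq)
    moreover have "sgn (w t) = cis (- t) * cis (\<zeta> t)"
      unfolding w by (simp add: sgn_div_norm norm_mult)
    moreover have "(cis (- \<zeta> t) - of_real n) * (cis (- t) * cis (\<zeta> t)) = cis (- t) - n *\<^sub>R (cis (- t) * cis (\<zeta> t))"
      by (simp add: left_diff_distrib cis_mult scaleR_conv_of_real)
    moreover have "g * exp (- \<mu> t) * exp (\<mu> t) = g" by (simp add: mult.assoc flip: exp_add)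
    moreover have "(x *\<^sub>R A) * (y *\<^sub>R B) = (x * y) *\<^sub>R (A * B)" for x y and A B :: complex
      by simp
    ultimately have "Complex \<mu>' (\<zeta>' - 1) * w t = g *\<^sub>R (cis (- t) - n *\<^sub>R sgn (w t))"
      by (simp only:)
    then show ?thesis by (simp add: scaleR_diff_right mult.commute)
  qed
  ultimately show ?thesis by simp
qed

text \<open>The upper half-plane avoids the branch cut of \<open>Ln\<close>, so the real and
  imaginary parts of \<open>Ln (z t)\<close> are differentiable for all times.\<close>

lemma pursuit_solution_of_curve:
  assumes z: "\<And>t. (z has_vector_derivative
      of_real (1 / ellipse_f a b t) - (n * (1 / ellipse_f a b t)) *\<^sub>R sgn (z t) + \<i> * z t) (at t)"
    and Im_pos: "\<And>t. Im (z t) > 0"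
  shows "\<exists>\<mu> \<zeta>. pursuit_solution a b n UNIV \<mu> \<zeta> \<and> z = pursuit_curve \<mu> \<zeta>"
proof (intro exI conjI)
  define \<mu> \<zeta> where "\<mu> = (\<lambda>t. Re (Ln (z t)))" and "\<zeta> = (\<lambda>t. Im (Ln (z t)))"
  have nz: "z t \<noteq> 0" for t using Im_pos[of t] by auto
  have exp_Ln: "exp (Complex (\<mu> t) (\<zeta> t)) = z t" for t
  proof -
    have "Complex (\<mu> t) (\<zeta> t) = Ln (z t)" by (simp add: complex_eq_iff \<mu>_def \<zeta>_def)
    then show ?thesis using nz by simp
  qed
  show "z = pursuit_curve \<mu> \<zeta>"
    unfolding pursuit_curve_def using exp_Ln by (simp add: complex_eq_cancel_iff2 Complex_eq fun_eq_iff)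
  have "(\<mu> has_real_derivative exp (- \<mu> t) * (cos (\<zeta> t) - n) / ellipse_f a b t) (at t) \<and>
        (\<zeta> has_real_derivative - (exp (- \<mu> t) * sin (\<zeta> t) / ellipse_f a b t) + 1) (at t)" for t
  proof -
    define g where "g = 1 / ellipse_f a b t"
    define z' where "z' = of_real g - (n * g) *\<^sub>R sgn (z t) + \<i> * z t"
    have "z t \<notin> \<real>\<^sub>\<le>\<^sub>0" using Im_pos[of t] complex_nonpos_Reals_iff by auto
    then have "(Ln has_field_derivative inverse (z t)) (at (z t))" by (rule has_field_derivative_Ln)
    then have "(Ln \<circ> z has_vector_derivative z' * inverse (z t)) (at t)"
      using z[of t] unfolding z'_def g_def by (intro field_vector_diff_chain_at)
    moreover have "z' * inverse (z t) = Complex (exp (- \<mu> t) * (cos (\<zeta> t) - n) * g) (1 - exp (- \<mu> t) * sin (\<zeta> t) * g)"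
    proof -
      have zt: "z t = exp (\<mu> t) *\<^sub>R cis (\<zeta> t)"
        using exp_Ln[of t] by (simp add: exp_eq_polar scaleR_conv_of_real)
      have "sgn (z t) = cis (\<zeta> t)" unfolding zt by (simp add: sgn_div_norm)
      then have "z' * inverse (z t) = of_real g * inverse (z t) - (n * g) *\<^sub>R (cis (\<zeta> t) * inverse (z t)) + \<i>"
        using nz[of t] unfolding z'_def by (simp add: distrib_right left_diff_distrib)
      moreover have "inverse (z t) = exp (- \<mu> t) *\<^sub>R cis (- \<zeta> t)"
        unfolding zt by (simp add: exp_minus inverse_scaleR_distrib cis_inverse)
      moreover have "cis (\<zeta> t) * (exp (- \<mu> t) *\<^sub>R cis (- \<zeta> t)) = of_real (exp (- \<mu> t))"
        by (simp add: cis_mult scaleR_conv_of_real)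
      ultimately have "z' * inverse (z t) = of_real g * (exp (- \<mu> t) *\<^sub>R cis (- \<zeta> t))
          - (n * g) *\<^sub>R of_real (exp (- \<mu> t)) + \<i>" by (simp only:)
      then show ?thesis by (simp add: complex_eq_iff algebra_simps)
    qed
    ultimately show ?thesis
      unfolding has_vector_derivative_complex_iff \<mu>_def \<zeta>_def by (simp add: g_def)
  qed
  then show "pursuit_solution a b n UNIV \<mu> \<zeta>" by (simp add: pursuit_solution_def)
qed

text \<open>With the uniform distance \<open>\<epsilon>\<close> as regularisation parameter, the
  orbit never enters the region where \<open>soft_dir\<close> differs from
  \<open>sgn\<close>.\<close>

lemma periodic_pursuit_solution_exists:
  assumes "a > 0" "b > 0" "0 < n" "n < 1"
  shows "\<exists>z. periodic_pursuit_solution a b n z"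
proof -
  interpret closed_pursuit "\<lambda>t. 1 / ellipse_f a b t" "ellipse_pos a b" n
    by (rule closed_pursuit_ellipse[OF assms])
  obtain \<epsilon> where \<epsilon>: "\<epsilon> > 0" "\<And>d Q t. \<lbrakk>d > 0; soft_orbit d Q\<rbrakk> \<Longrightarrow> \<epsilon> \<le> norm (view Q t)"
    by (rule soft_orbit_uniform_distance) blast
  obtain Q where Q: "soft_orbit \<epsilon> Q" by (rule soft_orbit_exists[OF \<epsilon>(1)])
  note far = \<epsilon>(2)[OF \<epsilon>(1) Q]
  have "soft_dir \<epsilon> (view Q t) = sgn (view Q t)" for t
    using soft_dir_eq[OF far] by (simp add: sgn_div_norm divide_inverse)
  then have "(view Q has_vector_derivative
      of_real (1 / ellipse_f a b t) - (n * (1 / ellipse_f a b t)) *\<^sub>R sgn (view Q t) + \<i> * view Q t) (at t)" for t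
    using soft_orbit_view_deriv[OF Q, of t] by simp
  moreover have "Im (view Q t) > 0" for t
    using far[of t] \<epsilon>(1) by (intro soft_orbit_Im_pos[OF \<epsilon>(1) Q]) auto
  ultimately have "\<exists>\<mu> \<zeta>. pursuit_solution a b n UNIV \<mu> \<zeta> \<and> view Q = pursuit_curve \<mu> \<zeta>"
    by (rule pursuit_solution_of_curve)
  then show ?thesis
    unfolding periodic_pursuit_solution_def using view_periodic[OF Q] by blast
qed

lemma pursuit_solution_converges:
  assumes ab: "a > 0" "b > 0" "0 < n" "n < 1"
    and zs: "periodic_pursuit_solution a b n zs"
    and T: "is_interval T" "\<not> bdd_above T" and sol: "pursuit_solution a b n T \<mu> \<zeta>"
  shows "((\<lambda>t. cmod (pursuit_curve \<mu> \<zeta> t - zs t)) \<longlongrightarrow> 0) at_top"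
proof -
  obtain \<mu>s \<zeta>s where s: "pursuit_solution a b n UNIV \<mu>s \<zeta>s" "zs = pursuit_curve \<mu>s \<zeta>s"
    and per: "\<And>t. zs (t + pi) = zs t"
    using zs unfolding periodic_pursuit_solution_def by blast
  interpret closed_pursuit "\<lambda>t. 1 / ellipse_f a b t" "ellipse_pos a b" n
    by (rule closed_pursuit_ellipse[OF ab])
  have "T \<noteq> {}" using T(2) by auto
  then obtain t0 where t0: "t0 \<in> T" by blast
  have ray: "t \<in> T" if "t0 \<le> t" for t
  proof -
    obtain u where "u \<in> T" "t < u" using T(2) by (meson bdd_above.unfold not_le)
    then show ?thesis using T(1) t0 that unfolding is_interval_1 by (meson less_imp_le)
  qed
  \<comment> \<open>One unit after \<open>t0\<close> all times are interior to \<open>T\<close>,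
    where the derivatives are two-sided.\<close>
  have int: "t \<in> interior T" if "t0 + 1 \<le> t" for t
    by (rule interiorI[of "{t0<..}"]) (use that ray in auto)
  interpret pursuit_pair "\<lambda>t. 1 / ellipse_f a b t" "ellipse_pos a b" n
    "\<lambda>t. cis (- t) * pursuit_curve \<mu> \<zeta> t" "\<lambda>t. cis (- t) * zs t" "t0 + 1"
  proof
    fix t
    show "cis (- (t + pi)) * zs (t + pi) = - (cis (- t) * zs t)"
      by (simp add: per complex_eq_iff)
    show "((\<lambda>t. cis (- t) * zs t) has_vector_derivative
      (1 / ellipse_f a b t) *\<^sub>R cis (- t) - (n * (1 / ellipse_f a b t)) *\<^sub>R sgn (cis (- t) * zs t)) (at t)"
      unfolding s(2) by (rule pursuit_solution_fixed_frame_deriv[OF s(1)]) simp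
    show "cis (- t) * zs t \<noteq> 0" "cis (- t) * pursuit_curve \<mu> \<zeta> t \<noteq> 0"
      by (simp_all add: s(2) pursuit_curve_def)
  qed (rule pursuit_solution_fixed_frame_deriv[OF sol int])
  have "cmod (cis (- t) * pursuit_curve \<mu> \<zeta> t - cis (- t) * zs t) = cmod (pursuit_curve \<mu> \<zeta> t - zs t)" for t
    by (simp add: norm_mult flip: right_diff_distrib)
  then show ?thesis using distance_tendsto_zero by simp
qed

theorem theorem3:
  fixes a b n :: real
  assumes "a \<ge> b" and "b > 0" and "0 < n" and "n < 1"
  shows "(\<exists>!z. periodic_pursuit_solution a b n z) \<and>
    (\<forall>zs. periodic_pursuit_solution a b n zs \<longrightarrow>
       (\<forall>T \<mu> \<zeta>. is_interval T \<and> \<not> bdd_above T \<and> pursuit_solution a b n T \<mu> \<zeta> \<longrightarrow>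
          ((\<lambda>\<phi>. cmod (pursuit_curve \<mu> \<zeta> \<phi> - zs \<phi>)) \<longlongrightarrow> 0) at_top))"
proof (intro conjI allI impI ex_ex1I)
  have a: "a > 0" using assms by simp
  note conv = pursuit_solution_converges[OF a assms(2-4)]
  show "\<exists>z. periodic_pursuit_solution a b n z"
    by (rule periodic_pursuit_solution_exists[OF a assms(2-4)])
  show "((\<lambda>\<phi>. cmod (pursuit_curve \<mu> \<zeta> \<phi> - zs \<phi>)) \<longlongrightarrow> 0) at_top"
    if "periodic_pursuit_solution a b n zs"
      "is_interval T \<and> \<not> bdd_above T \<and> pursuit_solution a b n T \<mu> \<zeta>" for zs T \<mu> \<zeta>
    by (rule conv[OF that(1)]) (use that(2) in auto)
  \<comment> \<open>For uniqueness, \<open>z1\<close> takes the part of the arbitrary solution: its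
    distance to \<open>z2\<close> tends to zero and has period \<open>pi\<close>, so it
    vanishes.\<close>
  fix z1 z2
  assume z: "periodic_pursuit_solution a b n z1" "periodic_pursuit_solution a b n z2"
  obtain \<mu> \<zeta> where s: "pursuit_solution a b n UNIV \<mu> \<zeta>" "z1 = pursuit_curve \<mu> \<zeta>"
    using z(1) unfolding periodic_pursuit_solution_def by blast
  have lim: "((\<lambda>t. cmod (z1 t - z2 t)) \<longlongrightarrow> 0) at_top"
    unfolding s(2)
  proof (rule conv[OF z(2) _ _ s(1)])
    show "\<not> bdd_above (UNIV :: real set)" by (metis UNIV_I bdd_above.unfold gt_ex not_le)
  qed simp
  show "z1 = z2"
  proof
    fix t
    have shift: "z1 (t + real k * pi) = z1 t \<and> z2 (t + real k * pi) = z2 t" for k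
    proof (induction k)
      case (Suc k)
      have "t + real (Suc k) * pi = (t + real k * pi) + pi" by (simp add: algebra_simps)
      then show ?case using Suc z unfolding periodic_pursuit_solution_def by metis
    qed simp
    have "filterlim (\<lambda>k. t + real k * pi) at_top sequentially"
      by (intro filterlim_tendsto_add_at_top[OF tendsto_const]
          filterlim_at_top_mult_tendsto_pos[OF tendsto_const] filterlim_real_sequentially) simp
    from filterlim_compose[OF lim this] have "(\<lambda>k. cmod (z1 t - z2 t)) \<longlonglongrightarrow> 0"
      by (simp add: shift)
    then show "z1 t = z2 t" by (simp add: LIMSEQ_const_iff)
  qed
qed

end
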